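(* Let $s\ge 1$ and $d\ge 1$ be integers. There exists a non-adaptive one-sided error tester for the property "$s$-binary rank at most $d$" of $n\times m$ $(0,1)$-matrices that makes $O(T\log T)=\tilde O\!\left(\binom{d}{\le s}2^d/\epsilon^2\right)$ queries, where $T=324\,d^2\binom{d}{\le s}2^d/\epsilon^2$. The same query bound is achievable by a non-adaptive one-sided error tester for the property "$s$-binary rank exactly $d$".
   Context: For a $(0,1)$-matrix $M$ of size $n\times m$, $M[i,j]$ denotes its $(i,j)$ entry and $[n]=\{1,\dots,n\}$. The $s$-binary rank ${\rm br}_s(M)$ is the minimal integer $d\ge 0$ such that there exist $d$ sets (rectangles) $I_k\times J_k$ with $I_k\subseteq[n]$, $J_k\subseteq[m]$, $k\in[d]$, with $M[i,j]=1$ for all $(i,j)\in I_k\times J_k$ and all $k$, and such that every $(i,j)$ with $M[i,j]=1$ lies in at least one and at most $s$ of the rectangles. $\binom{d}{\le s}=\sum_{i=0}^{s}\binom{d}{i}$. A matrix $M$ is $\epsilon$-far from a property if more than an $\epsilon$-fraction of its $nm$ entries must be modified to obtain a matrix with the property. A tester receives $0<\epsilon<1$, $d,s,n,m$ and query access to the entries of $M$; if $M$ has the property it accepts with probability at least $2/3$, and if $M$ is $\epsilon$-far from the property it rejects with probability at least $2/3$. It is one-sided if it accepts matrices with the property with probability $1$. It is non-adaptive if all its queries are fixed in advance (possibly using randomness) before any answer is seen. $\tilde O$ hides factors polylogarithmic in $\binom{d}{\le s}2^d$ and $1/\epsilon$. *)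

theory Defs
  imports "HOL-Probability.Probability"
begin

text \<open>A (0,1)-matrix of size n x m is a function M :: nat => nat => bool; only the
entries M i j with (i,j) in [n] x [m] = {1..n} x {1..m} are relevant (True = 1).\<close>

type_synonym bmatrix = "nat \<Rightarrow> nat \<Rightarrow> bool"

definition choose_le :: "nat \<Rightarrow> nat \<Rightarrow> nat" where
  "choose_le d s = (\<Sum>i\<le>s. d choose i)"

definition s_cover :: "nat \<Rightarrow> nat \<Rightarrow> nat \<Rightarrow> bmatrix \<Rightarrow> nat \<Rightarrow> bool" where
  "s_cover s n m M d \<longleftrightarrow>
     (\<exists>I J :: nat \<Rightarrow> nat set.
        (\<forall>k<d. I k \<subseteq> {1..n} \<and> J k \<subseteq> {1..m} \<and>
               (\<forall>i\<in>I k. \<forall>j\<in>J k. M i j)) \<and>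
        (\<forall>i\<in>{1..n}. \<forall>j\<in>{1..m}. M i j \<longrightarrow>
             1 \<le> card {k. k < d \<and> i \<in> I k \<and> j \<in> J k} \<and>
             card {k. k < d \<and> i \<in> I k \<and> j \<in> J k} \<le> s))"

definition s_binary_rank :: "nat \<Rightarrow> nat \<Rightarrow> nat \<Rightarrow> bmatrix \<Rightarrow> nat" where
  "s_binary_rank s n m M = (LEAST d. s_cover s n m M d)"

definition mdist :: "nat \<Rightarrow> nat \<Rightarrow> bmatrix \<Rightarrow> bmatrix \<Rightarrow> nat" where
  "mdist n m M M' = card {(i,j). i \<in> {1..n} \<and> j \<in> {1..m} \<and> M i j \<noteq> M' i j}"

definition eps_far :: "nat \<Rightarrow> nat \<Rightarrow> (bmatrix \<Rightarrow> bool) \<Rightarrow> real \<Rightarrow> bmatrix \<Rightarrow> bool" where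
  "eps_far n m P eps M \<longleftrightarrow> (\<forall>M'. P M' \<longrightarrow> real (mdist n m M M') > eps * real n * real m)"

text \<open>A non-adaptive randomized tester is a probability distribution over pairs (Q, D):
a set Q of query positions in [n] x [m], chosen before any answer is seen, and a
decision D (True = accept) that depends only on the answers to the queries in Q.
The tester is run on M by evaluating D on the entries of M.\<close>
type_synonym tester = "((nat \<times> nat) set \<times> ((nat \<times> nat \<Rightarrow> bool) \<Rightarrow> bool)) pmf"

definition accept_prob :: "tester \<Rightarrow> bmatrix \<Rightarrow> real" where
  "accept_prob T M = measure_pmf.prob T {(Q, D). D (\<lambda>(i,j). M i j)}"

definition nonadaptive_one_sided_tester ::
  "nat \<Rightarrow> nat \<Rightarrow> (bmatrix \<Rightarrow> bool) \<Rightarrow> real \<Rightarrow> real \<Rightarrow> tester \<Rightarrow> bool" where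
  "nonadaptive_one_sided_tester n m P eps qbound T \<longleftrightarrow>
     (\<forall>(Q, D) \<in> set_pmf T.
        Q \<subseteq> {1..n} \<times> {1..m} \<and> real (card Q) \<le> qbound \<and>
        (\<forall>f g. (\<forall>p\<in>Q. f p = g p) \<longrightarrow> D f = D g)) \<and>
     (\<forall>M. P M \<longrightarrow> accept_prob T M = 1) \<and>
     (\<forall>M. eps_far n m P eps M \<longrightarrow> 1 - accept_prob T M \<ge> 2/3)"

end

theory Submission
  imports Defs
begin

text \<open>
  If \<open>M\<close> has \<open>s\<close>-binary rank at most \<open>d\<close>, rows and columns are described by subsets of \<open>[d]\<close>
  any two of which meet in at most \<open>s\<close> points, so Kleitman's correlation inequality bounds
  (number of distinct rows) * (number of distinct columns) by \<open>K 2^d\<close>, where \<open>K\<close> is \<open>choose_le d s\<close>.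

  The tester draws i.i.d. rows and columns, queries for each scale \<open>k \<le> d\<close> a prefix of about
  \<open>2^k ln T / eps\<close> rows against a prefix of about \<open>K 2^(d-k) / eps\<close> columns, and accepts iff some matrix with
  the property agrees with all answers. At a fixed scale, with high probability one of the following holds:
  the sample shows more than \<open>2^k\<close> distinct rows, or more than \<open>K 2^(d+1-k)\<close> distinct columns, or almost
  every row and column of \<open>M\<close> looks like a sampled one and columns that look alike almost agree.
  In the last case blowing up the sampled submatrix gives a matrix of rank at most \<open>d\<close> close to \<open>M\<close>.
  For \<open>M\<close> far from the property the first alternative must hold at scale 0 and the second at scale \<open>d\<close>, so
  the switch between them, at some \<open>k\<close> and \<open>k + 1\<close>, violates the product bound.

  For rank exactly \<open>d\<close>: if \<open>n\<close> or \<open>m\<close> is at least \<open>2 d / eps\<close>, a matrix of rank at most \<open>d\<close> can be moved to rank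
  exactly \<open>d\<close> by replacing at most \<open>d\<close> rows or columns, and otherwise all entries can be queried.
\<close>

section \<open>Kleitman's correlation inequality and Sgall's bound on set families with small
  cross-intersections\<close>

definition down_closed :: "'a set set \<Rightarrow> bool" where
  "down_closed F \<longleftrightarrow> (\<forall>A\<in>F. \<forall>B. B \<subseteq> A \<longrightarrow> B \<in> F)"

text \<open>Deleting \<open>x\<close> maps the members containing \<open>x\<close> bijectively onto
  the second family. These two sections carry the induction on the ground set below.\<close>

lemma card_split_at:
  assumes "finite F"
  shows "card F = card {A \<in> F. x \<notin> A} + card {A. x \<notin> A \<and> insert x A \<in> F}"
proof -
  let ?F0 = "{A \<in> F. x \<notin> A}" and ?F1 = "{A. x \<notin> A \<and> insert x A \<in> F}"
  have inj: "inj_on (insert x) ?F1"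
    by (rule inj_onI) (metis (mono_tags, lifting) insert_ident mem_Collect_eq)
  have img: "insert x ` ?F1 = {A \<in> F. x \<in> A}"
  proof
    show "{A \<in> F. x \<in> A} \<subseteq> insert x ` ?F1"
    proof
      fix A assume "A \<in> {A \<in> F. x \<in> A}"
      then show "A \<in> insert x ` ?F1"
        by (intro image_eqI[of _ _ "A - {x}"]) (auto simp: insert_absorb)
    qed
  qed auto
  have "F = ?F0 \<union> {A \<in> F. x \<in> A}" by auto
  then have "card F = card ?F0 + card {A \<in> F. x \<in> A}"
    using assms by (metis (no_types, lifting) card_Un_disjoint disjoint_iff finite_Un mem_Collect_eq)
  then show ?thesis using card_image[OF inj] img by simp
qed

text \<open>The right side exceeds the left by \<open>(a0 - a1) * (b0 - b1)\<close>: Chebyshev's sum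
  inequality for two terms.\<close>

lemma mult_add_le_twice:
  fixes a0 a1 b0 b1 :: nat
  assumes "a1 \<le> a0" "b1 \<le> b0"
  shows "(a0 + a1) * (b0 + b1) \<le> 2 * (a0 * b0 + a1 * b1)"
proof -
  obtain p q where "a0 = a1 + p" "b0 = b1 + q"
    using assms by (meson le_iff_add)
  then show ?thesis by (simp add: algebra_simps)
qed

text \<open>Induction on the ground set. The sections of a down-closed family without and with
  \<open>x\<close> are again down-closed, and the second is contained in the first. Chebyshev's
  inequality therefore pairs like sections with like at the cost of a factor 2, which is the growth
  of \<open>2 ^ card S\<close>.\<close>

lemma kleitman:
  assumes "finite S"
  shows "\<lbrakk>F \<subseteq> Pow S; G \<subseteq> Pow S; down_closed F; down_closed G\<rbrakk>
    \<Longrightarrow> card F * card G \<le> 2 ^ card S * card (F \<inter> G)"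
  using assms
proof (induction S arbitrary: F G rule: finite_induct)
  case empty
  then have "F = {} \<or> F = {{}}" "G = {} \<or> G = {{}}" by auto
  then show ?case by auto
next
  case (insert x S)
  let ?z = "\<lambda>H. {A \<in> H. x \<notin> A}" and ?o = "\<lambda>H. {A. x \<notin> A \<and> insert x A \<in> H}"
  have fin: "finite H" if "H \<subseteq> Pow (insert x S)" for H
    using that insert.hyps by (meson finite_Pow_iff finite_insert finite_subset)
  have sub: "?z H \<subseteq> Pow S" "?o H \<subseteq> Pow S" if "H \<subseteq> Pow (insert x S)" for H
    using that by auto
  have dn: "down_closed (?z H)" "down_closed (?o H)" "?o H \<subseteq> ?z H" if "down_closed H" for H
  proof -
    show "down_closed (?z H)" using that unfolding down_closed_def by auto
    show "?o H \<subseteq> ?z H" using that unfolding down_closed_def by blast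
    have "insert x B \<in> H" if "insert x A \<in> H" "B \<subseteq> A" for A B
      using \<open>down_closed H\<close> that Set.insert_mono[OF that(2), of x] unfolding down_closed_def by blast
    then show "down_closed (?o H)" unfolding down_closed_def by blast
  qed
  have le: "card (?o H) \<le> card (?z H)" if "H \<subseteq> Pow (insert x S)" "down_closed H" for H
    using dn(3)[OF that(2)] fin[OF that(1)] by (intro card_mono) auto
  have "card F * card G = (card (?z F) + card (?o F)) * (card (?z G) + card (?o G))"
    using card_split_at[OF fin[OF insert.prems(1)], of x] card_split_at[OF fin[OF insert.prems(2)], of x]
    by simp
  also have "\<dots> \<le> 2 * (card (?z F) * card (?z G) + card (?o F) * card (?o G))"
    using insert.prems by (intro mult_add_le_twice le)
  also have "\<dots> \<le> 2 * (2 ^ card S * card (?z F \<inter> ?z G) + 2 ^ card S * card (?o F \<inter> ?o G))"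
    using insert.prems by (intro mult_left_mono add_mono insert.IH sub dn) auto
  also have "\<dots> = 2 ^ card (insert x S) * (card (?z (F \<inter> G)) + card (?o (F \<inter> G)))"
  proof -
    have "?z F \<inter> ?z G = ?z (F \<inter> G)" "?o F \<inter> ?o G = ?o (F \<inter> G)" by auto
    then show ?thesis using insert.hyps by (simp add: algebra_simps)
  qed
  also have "card (?z (F \<inter> G)) + card (?o (F \<inter> G)) = card (F \<inter> G)"
    using card_split_at[of "F \<inter> G" x] fin[OF insert.prems(1)] by simp
  finally show ?case .
qed

lemma card_subsets_le:
  assumes "finite S"
  shows "card {A. A \<subseteq> S \<and> card A \<le> s} = choose_le (card S) s"
proof -
  have "{A. A \<subseteq> S \<and> card A \<le> s} = (\<Union>i\<le>s. {A. A \<subseteq> S \<and> card A = i})" by auto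
  also have "card \<dots> = (\<Sum>i\<le>s. card {A. A \<subseteq> S \<and> card A = i})"
    using assms by (intro card_UN_disjoint) (auto intro: finite_subset[OF _ finite_Pow_iff[THEN iffD2, OF assms]])
  also have "\<dots> = choose_le (card S) s"
    unfolding choose_le_def using n_subsets[OF assms] by simp
  finally show ?thesis .
qed

text \<open>Sgall's bound. Passing to the down-closures preserves the hypothesis, and a set in the
  intersection of the down-closures meets itself in at most \<open>s\<close> points.\<close>

lemma sgall_bound:
  assumes "finite S" "F \<subseteq> Pow S" "G \<subseteq> Pow S"
    and meet: "\<And>A B. A \<in> F \<Longrightarrow> B \<in> G \<Longrightarrow> card (A \<inter> B) \<le> s"
  shows "card F * card G \<le> choose_le (card S) s * 2 ^ card S"
proof -
  define F' where "F' = (\<Union>A\<in>F. Pow A)"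
  define G' where "G' = (\<Union>B\<in>G. Pow B)"
  have sub: "F' \<subseteq> Pow S" "G' \<subseteq> Pow S" using assms(2,3) unfolding F'_def G'_def by blast+
  have dn: "down_closed F'" "down_closed G'" unfolding down_closed_def F'_def G'_def by auto
  have fin: "finite (Pow S)" using assms by simp
  have "card C \<le> s" if C: "C \<in> F' \<inter> G'" for C
  proof -
    obtain A B where AB: "A \<in> F" "B \<in> G" "C \<subseteq> A \<inter> B" using C unfolding F'_def G'_def by blast
    then have "finite (A \<inter> B)" using assms by (meson PowD finite_Int finite_subset in_mono)
    then have "card C \<le> card (A \<inter> B)" using AB by (intro card_mono)
    then show ?thesis using meet[OF AB(1,2)] by simp
  qed
  then have "F' \<inter> G' \<subseteq> {A. A \<subseteq> S \<and> card A \<le> s}" using sub by auto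
  then have c: "card (F' \<inter> G') \<le> choose_le (card S) s"
    unfolding card_subsets_le[OF assms(1), symmetric]
    using assms(1) by (intro card_mono) auto
  have "card F * card G \<le> card F' * card G'"
    using sub fin by (intro mult_mono card_mono) (auto intro: finite_subset simp: F'_def G'_def)
  also have "\<dots> \<le> 2 ^ card S * card (F' \<inter> G')"
    by (rule kleitman[OF assms(1) sub dn])
  also have "\<dots> \<le> choose_le (card S) s * 2 ^ card S" using c by simp
  finally show ?thesis .
qed

section \<open>Traces of rows and columns on a sample\<close>

definition row_trace :: "('a \<Rightarrow> 'b \<Rightarrow> bool) \<Rightarrow> 'b set \<Rightarrow> 'a \<Rightarrow> 'b set" where
  "row_trace R Y x = {y \<in> Y. R x y}"

abbreviation (input) mtransp :: "('a \<Rightarrow> 'b \<Rightarrow> bool) \<Rightarrow> 'b \<Rightarrow> 'a \<Rightarrow> bool" where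
  "mtransp M \<equiv> (\<lambda>j i. M i j)"

text \<open>On \<open>X\<close> the value of \<open>f\<close> is determined by that of
  \<open>g\<close>, so \<open>f\<close> factors through \<open>g\<close> by way of a chosen
  preimage.\<close>

lemma card_image_le_factor:
  assumes "finite X" "\<And>x y. x \<in> X \<Longrightarrow> y \<in> X \<Longrightarrow> g x = g y \<Longrightarrow> f x = f y"
  shows "card (f ` X) \<le> card (g ` X)"
proof -
  have "f x = f (inv_into X g (g x))" if "x \<in> X" for x
    using assms(2)[OF that, of "inv_into X g (g x)"] that by (simp add: inv_into_into f_inv_into_f)
  then have "f ` X \<subseteq> (\<lambda>z. f (inv_into X g z)) ` g ` X" by (auto simp: image_image)
  then show ?thesis using assms(1) by (meson card_image_le card_mono finite_imageI le_trans)
qed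

section \<open>Probability estimates for independent draws\<close>

lemma measure_bind_pmf_eq_expectation:
  "measure_pmf.prob (bind_pmf p f) A = measure_pmf.expectation p (\<lambda>x. measure_pmf.prob (f x) A)"
proof -
  have int: "integrable (measure_pmf p) (\<lambda>x. measure_pmf.prob (f x) A)"
    by (rule measure_pmf.integrable_const_bound[of _ 1]) auto
  have "ennreal (measure_pmf.prob (bind_pmf p f) A) = (\<integral>\<^sup>+x. ennreal (measure_pmf.prob (f x) A) \<partial>p)"
    by (simp flip: measure_pmf.emeasure_eq_measure)
  also have "\<dots> = ennreal (measure_pmf.expectation p (\<lambda>x. measure_pmf.prob (f x) A))"
    by (rule nn_integral_eq_integral[OF int]) simp
  finally show ?thesis by (simp add: integral_nonneg_AE)
qed

text \<open>Law of total probability for a first draw inside or outside \<open>D\<close>. With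
  \<open>D\<close> empty it turns a uniform bound on the support into a bound for the compound
  draw.\<close>

lemma measure_bind_pmf_le_split:
  assumes "\<And>x. x \<in> D \<Longrightarrow> measure_pmf.prob (f x) A \<le> c"
    and "\<And>x. x \<in> set_pmf p \<Longrightarrow> x \<notin> D \<Longrightarrow> measure_pmf.prob (f x) A \<le> c'"
  shows "measure_pmf.prob (bind_pmf p f) A \<le>
    measure_pmf.prob p D * c + (1 - measure_pmf.prob p D) * c'"
proof -
  have "measure_pmf.prob (bind_pmf p f) A = measure_pmf.expectation p (\<lambda>x. measure_pmf.prob (f x) A)"
    by (rule measure_bind_pmf_eq_expectation)
  also have "\<dots> \<le> measure_pmf.expectation p (\<lambda>x. c * indicator D x + c' * indicator (- D) x)"
  proof (rule integral_mono_AE)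
    show "integrable (measure_pmf p) (\<lambda>x. measure_pmf.prob (f x) A)"
      by (rule measure_pmf.integrable_const_bound[of _ 1]) auto
    show "integrable (measure_pmf p) (\<lambda>x. c * indicator D x + c' * indicator (- D) x)"
      by (intro Bochner_Integration.integrable_add integrable_mult_right) (auto simp: integrable_indicator_iff measure_pmf.emeasure_eq_measure)
    show "AE x in measure_pmf p. measure_pmf.prob (f x) A \<le> c * indicator D x + c' * indicator (- D) x"
      using assms by (auto simp: AE_measure_pmf_iff indicator_def)
  qed
  also have "\<dots> = c * measure_pmf.prob p D + c' * measure_pmf.prob p (- D)"
    by (subst Bochner_Integration.integral_add)
       (auto simp: integrable_indicator_iff measure_pmf.emeasure_eq_measure)
  also have "measure_pmf.prob p (- D) = 1 - measure_pmf.prob p D"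
    using measure_pmf.prob_compl[of D p] by (simp add: Compl_eq_Diff_UNIV)
  finally show ?thesis by (simp add: mult.commute)
qed

lemma pair_pmf_eq_bind_map: "pair_pmf p q = bind_pmf p (\<lambda>x. map_pmf (Pair x) q)"
  by (simp add: pair_pmf_def map_pmf_def)

lemma measure_pair_pmf_le_fst:
  assumes "\<And>x. x \<in> set_pmf p \<Longrightarrow> measure_pmf.prob q {y. E x y} \<le> c"
  shows "measure_pmf.prob (pair_pmf p q) {(x, y). E x y} \<le> c"
  unfolding pair_pmf_eq_bind_map
  using measure_bind_pmf_le_split[of "{}" "\<lambda>x. map_pmf (Pair x) q" "{(x, y). E x y}" 0 p c] assms
  by (simp add: vimage_def)

lemma measure_pair_pmf_le_snd:
  assumes "\<And>y. y \<in> set_pmf q \<Longrightarrow> measure_pmf.prob p {x. E x y} \<le> c"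
  shows "measure_pmf.prob (pair_pmf p q) {(x, y). E x y} \<le> c"
proof -
  have "measure_pmf.prob (pair_pmf p q) {(x, y). E x y} = measure_pmf.prob (pair_pmf q p) {(y, x). E x y}"
    by (subst pair_commute_pmf) (simp add: vimage_def case_prod_unfold)
  also have "\<dots> \<le> c"
    by (rule measure_pair_pmf_le_fst) (rule assms)
  finally show ?thesis .
qed

text \<open>Markov's inequality for the mass of the section of \<open>E\<close> at \<open>x\<close>;
  its expectation is the mass of \<open>E\<close> under the product, which is at most
  \<open>c\<close> by drawing \<open>y\<close> first.\<close>

lemma measure_section_ge_le:
  assumes "\<And>y. y \<in> set_pmf q \<Longrightarrow> measure_pmf.prob p {x. E x y} \<le> c" and "0 < \<delta>"
  shows "measure_pmf.prob p {x. \<delta> \<le> measure_pmf.prob q {y. E x y}} \<le> c / \<delta>"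
proof -
  let ?S = "{x. \<delta> \<le> measure_pmf.prob q {y. E x y}}"
  have "\<delta> * measure_pmf.prob p ?S = measure_pmf.expectation p (\<lambda>x. \<delta> * indicator ?S x)"
    by simp
  also have "\<dots> \<le> measure_pmf.expectation p (\<lambda>x. measure_pmf.prob q {y. E x y})"
  proof (rule integral_mono_AE)
    show "integrable (measure_pmf p) (\<lambda>x. measure_pmf.prob q {y. E x y})"
      by (rule measure_pmf.integrable_const_bound[of _ 1]) auto
    show "integrable (measure_pmf p) (\<lambda>x. \<delta> * indicator ?S x)"
      by (intro integrable_mult_right) (auto simp: integrable_indicator_iff measure_pmf.emeasure_eq_measure)
  qed (auto simp: indicator_def)
  also have "\<dots> = measure_pmf.prob (pair_pmf p q) {(x, y). E x y}"
    unfolding pair_pmf_eq_bind_map measure_bind_pmf_eq_expectation by (simp add: vimage_def)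
  also have "\<dots> \<le> c"
    by (rule measure_pair_pmf_le_snd) (rule assms)
  finally show ?thesis using assms(2) by (simp add: field_simps)
qed

lemma replicate_pmf_Suc_map:
  "replicate_pmf (Suc t) p = bind_pmf p (\<lambda>x. map_pmf ((#) x) (replicate_pmf t p))"
  by (simp add: map_pmf_def)

text \<open>As long as the unseen classes have mass at least \<open>\<delta>\<close>, every draw hits a new class with
  probability at least \<open>\<delta>\<close>; weighting each missing class by a factor 2 makes the bound inductive.\<close>

lemma unseen_mass_bound:
  fixes p :: "'a pmf" and g :: "'a \<Rightarrow> 'b"
  assumes "0 \<le> \<delta>" "\<delta> \<le> 1"
  shows "measure_pmf.prob (replicate_pmf t p)
     {xs. \<delta> \<le> measure_pmf.prob p {x. g x \<notin> V \<union> g ` set xs} \<and> card (g ` set xs - V) \<le> k}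
     \<le> 2 ^ k * (1 - \<delta> / 2) ^ t"
proof (induction t arbitrary: V k)
  case 0
  have "measure_pmf.prob (replicate_pmf 0 p) A \<le> 2 ^ k" for A
    using measure_pmf.prob_le_1[of "replicate_pmf 0 p" A] one_le_power[of "2::real" k] by linarith
  then show ?case by simp
next
  case (Suc t)
  let ?E = "\<lambda>V k. {xs. \<delta> \<le> measure_pmf.prob p {x. g x \<notin> V \<union> g ` set xs} \<and> card (g ` set xs - V) \<le> k}"
  let ?D = "{x. g x \<notin> V}"
  let ?u = "measure_pmf.prob p ?D" and ?c = "2 ^ k * (1 - \<delta> / 2) ^ t"
  have c0: "0 \<le> ?c" using assms by simp
  show ?case
  proof (cases "\<delta> \<le> ?u")
    case False
    \<comment> \<open>The unseen mass only shrinks as draws are added, so starting below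
      \<open>\<delta>\<close> makes the event empty.\<close>
    have "measure_pmf.prob p {x. g x \<notin> V \<union> g ` set xs} \<le> ?u" for xs
      by (rule measure_pmf.finite_measure_mono) auto
    then have "?E V k = {}" using False by (auto dest: order_trans)
    then have "measure_pmf.prob (replicate_pmf (Suc t) p) (?E V k) = 0" by (simp only: measure_empty)
    then show ?thesis using assms by (simp only:) simp
  next
    case True
    \<comment> \<open>A draw from a new class uses up one of the \<open>k\<close> permitted ones:
      the rest of the sample is judged with \<open>insert (g x) V\<close> and \<open>k - 1\<close>,
      which halves the bound; for \<open>k = 0\<close> the event is impossible.\<close>
    have new: "measure_pmf.prob (map_pmf ((#) x) (replicate_pmf t p)) (?E V k) \<le> ?c / 2" if x: "x \<in> ?D" for x
    proof -
      have card: "card (g ` set (x # xs) - V) = Suc (card (g ` set xs - insert (g x) V))" for xs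
      proof -
        have "g ` set (x # xs) - V = insert (g x) (g ` set xs - insert (g x) V)" using x by auto
        then show ?thesis by simp
      qed
      show ?thesis
      proof (cases k)
        case 0
        then have eq: "(#) x -` ?E V k = {}" unfolding vimage_def mem_Collect_eq card by simp
        show ?thesis unfolding measure_map_pmf eq using c0 by simp
      next
        case (Suc k')
        have eq: "(#) x -` ?E V k = ?E (insert (g x) V) k'"
          unfolding vimage_def mem_Collect_eq card Suc by (simp add: insert_commute)
        show ?thesis unfolding measure_map_pmf eq using Suc.IH[of "insert (g x) V" k'] Suc by simp
      qed
    qed
    have old: "measure_pmf.prob (map_pmf ((#) x) (replicate_pmf t p)) (?E V k) \<le> ?c" if x: "x \<notin> ?D" for x
    proof -
      have "V \<union> g ` set (x # xs) = V \<union> g ` set xs" "g ` set (x # xs) - V = g ` set xs - V" for xs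
        using x by auto
      then have eq: "(#) x -` ?E V k = ?E V k" unfolding vimage_def mem_Collect_eq by (simp only:)
      show ?thesis unfolding measure_map_pmf eq by (rule Suc.IH)
    qed
    have "measure_pmf.prob (replicate_pmf (Suc t) p) (?E V k) \<le> ?u * (?c / 2) + (1 - ?u) * ?c"
      unfolding replicate_pmf_Suc_map by (intro measure_bind_pmf_le_split new old)
    also have "\<dots> = ?c * (1 - ?u / 2)" by (simp add: algebra_simps)
    also have "\<dots> \<le> ?c * (1 - \<delta> / 2)" using True c0 by (intro mult_left_mono) auto
    finally show ?thesis by (simp add: mult_ac)
  qed
qed

lemma miss_prob_le:
  assumes "\<delta> \<le> measure_pmf.prob p D" "\<delta> \<le> 1"
  shows "measure_pmf.prob (replicate_pmf t p) {xs. set xs \<inter> D = {}} \<le> (1 - \<delta>) ^ t"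
proof (induction t)
  case 0
  show ?case by simp
next
  case (Suc t)
  have "measure_pmf.prob (replicate_pmf (Suc t) p) {xs. set xs \<inter> D = {}}
    \<le> measure_pmf.prob p D * 0 + (1 - measure_pmf.prob p D) * (1 - \<delta>) ^ t"
    unfolding replicate_pmf_Suc_map
  proof (rule measure_bind_pmf_le_split)
    show "measure_pmf.prob (map_pmf ((#) x) (replicate_pmf t p)) {xs. set xs \<inter> D = {}} \<le> 0" if "x \<in> D" for x
      using that by (simp add: vimage_def)
    show "measure_pmf.prob (map_pmf ((#) x) (replicate_pmf t p)) {xs. set xs \<inter> D = {}} \<le> (1 - \<delta>) ^ t" if "x \<notin> D" for x
      using that Suc.IH by (simp add: vimage_def)
  qed
  also have "\<dots> \<le> (1 - \<delta>) * (1 - \<delta>) ^ t"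
    using assms by (simp add: mult_right_mono)
  finally show ?case by simp
qed

lemma map_take_replicate_pmf:
  "a \<le> b \<Longrightarrow> map_pmf (take a) (replicate_pmf b p) = replicate_pmf a p"
proof (induction a arbitrary: b)
  case 0
  then show ?case by simp
next
  case (Suc a)
  then obtain b' where b: "b = Suc b'" "a \<le> b'" by (metis Suc_le_D Suc_le_mono)
  have "map_pmf (take (Suc a)) (replicate_pmf b p) = bind_pmf p (\<lambda>x. map_pmf ((#) x) (map_pmf (take a) (replicate_pmf b' p)))"
    unfolding b replicate_pmf_Suc_map map_bind_pmf by (simp add: pmf.map_comp o_def)
  then show ?case unfolding replicate_pmf_Suc_map Suc.IH[OF b(2)] .
qed

text \<open>All scales share prefixes of one sample; this allows each scale to be analysed as if it
  had a fresh sample of its own.\<close>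

lemma measure_pair_replicate_take:
  assumes "a \<le> a'" "b \<le> b'"
  shows "measure_pmf.prob (pair_pmf (replicate_pmf a' p) (replicate_pmf b' q)) {(xs, ys). E (take a xs) (take b ys)}
    = measure_pmf.prob (pair_pmf (replicate_pmf a p) (replicate_pmf b q)) {(xs, ys). E xs ys}"
proof -
  have "pair_pmf (replicate_pmf a p) (replicate_pmf b q)
    = map_pmf (\<lambda>(xs, ys). (take a xs, take b ys)) (pair_pmf (replicate_pmf a' p) (replicate_pmf b' q))"
    unfolding map_pair using assms by (simp add: map_take_replicate_pmf)
  then show ?thesis by (simp add: vimage_def case_prod_unfold)
qed

section \<open>Rectangle covers and the \<open>s\<close>-binary rank\<close>

text \<open>The body of \<open>s_cover\<close> with the witnessing rectangles named, so that they
  can be obtained once and their properties used separately.\<close>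

definition s_cover_by ::
  "nat \<Rightarrow> nat \<Rightarrow> nat \<Rightarrow> bmatrix \<Rightarrow> nat \<Rightarrow> (nat \<Rightarrow> nat set) \<Rightarrow> (nat \<Rightarrow> nat set) \<Rightarrow> bool" where
  "s_cover_by s n m M d I J \<longleftrightarrow>
     (\<forall>k<d. I k \<subseteq> {1..n} \<and> J k \<subseteq> {1..m} \<and> (\<forall>i\<in>I k. \<forall>j\<in>J k. M i j)) \<and>
     (\<forall>i\<in>{1..n}. \<forall>j\<in>{1..m}. M i j \<longrightarrow>
        1 \<le> card {k. k < d \<and> i \<in> I k \<and> j \<in> J k} \<and> card {k. k < d \<and> i \<in> I k \<and> j \<in> J k} \<le> s)"

lemma s_cover_iff: "s_cover s n m M d \<longleftrightarrow> (\<exists>I J. s_cover_by s n m M d I J)"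
  unfolding s_cover_def s_cover_by_def by (rule refl)

lemma s_cover_byD:
  assumes "s_cover_by s n m M d I J"
  shows "k < d \<Longrightarrow> I k \<subseteq> {1..n}" "k < d \<Longrightarrow> J k \<subseteq> {1..m}"
    and "k < d \<Longrightarrow> i \<in> I k \<Longrightarrow> j \<in> J k \<Longrightarrow> M i j"
    and "i \<in> {1..n} \<Longrightarrow> j \<in> {1..m} \<Longrightarrow> M i j \<Longrightarrow>
      1 \<le> card {k. k < d \<and> i \<in> I k \<and> j \<in> J k} \<and> card {k. k < d \<and> i \<in> I k \<and> j \<in> J k} \<le> s"
  using assms unfolding s_cover_by_def by simp_all

lemma s_coverI:
  fixes I J :: "nat \<Rightarrow> nat set"
  assumes "\<And>k. k < d \<Longrightarrow> I k \<subseteq> {1..n}" "\<And>k. k < d \<Longrightarrow> J k \<subseteq> {1..m}"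
    and "\<And>k i j. k < d \<Longrightarrow> i \<in> I k \<Longrightarrow> j \<in> J k \<Longrightarrow> M i j"
    and "\<And>i j. i \<in> {1..n} \<Longrightarrow> j \<in> {1..m} \<Longrightarrow> M i j \<Longrightarrow>
      1 \<le> card {k. k < d \<and> i \<in> I k \<and> j \<in> J k} \<and> card {k. k < d \<and> i \<in> I k \<and> j \<in> J k} \<le> s"
  shows "s_cover s n m M d"
  unfolding s_cover_def using assms by (intro exI[of _ I] exI[of _ J]) simp

text \<open>Row \<open>i\<close> is labelled by the set \<open>A i\<close> of rectangles whose row
  side contains it, column \<open>j\<close> likewise by \<open>B j\<close>. An entry is 1 iff its
  labels meet, so labels determine traces, and Sgall's bound on the numbers of labels carries
  over.\<close>

lemma s_cover_traces:
  assumes cov: "s_cover s n m M d" and X: "X \<subseteq> {1..n}" and Y: "Y \<subseteq> {1..m}"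
  shows "card (row_trace M Y ` X) * card (row_trace (mtransp M) X ` Y) \<le> choose_le d s * 2 ^ d"
    and "card (row_trace M Y ` X) \<le> 2 ^ d" and "card (row_trace (mtransp M) X ` Y) \<le> 2 ^ d"
proof -
  obtain I J where "s_cover_by s n m M d I J"
    using cov unfolding s_cover_iff by blast
  note rect = s_cover_byD(3)[OF this] and cnt = s_cover_byD(4)[OF this]
  define A where "A = (\<lambda>i. {k. k < d \<and> i \<in> I k})"
  define B where "B = (\<lambda>j. {k. k < d \<and> j \<in> J k})"
  have AB: "{k. k < d \<and> i \<in> I k \<and> j \<in> J k} = A i \<inter> B j" for i j unfolding A_def B_def by auto
  have iff: "M i j \<longleftrightarrow> A i \<inter> B j \<noteq> {}" if "i \<in> X" "j \<in> Y" for i j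
  proof
    assume "M i j"
    then have "1 \<le> card (A i \<inter> B j)" using cnt[OF subsetD[OF X that(1)] subsetD[OF Y that(2)]] unfolding AB by blast
    then show "A i \<inter> B j \<noteq> {}" by auto
  next
    assume "A i \<inter> B j \<noteq> {}"
    then show "M i j" using rect unfolding A_def B_def by auto
  qed
  \<comment> \<open>On zero entries the labels are disjoint, so the bound holds for all pairs and
    not only for the covered ones.\<close>
  have meet: "card (A i \<inter> B j) \<le> s" if "i \<in> X" "j \<in> Y" for i j
  proof (cases "M i j")
    case True then show ?thesis using cnt[OF subsetD[OF X that(1)] subsetD[OF Y that(2)]] unfolding AB by blast
  next
    case False then show ?thesis using iff[OF that] by simp
  qed
  have fin: "finite X" "finite Y" using X Y finite_subset by auto
  have sub: "A ` X \<subseteq> Pow {..<d}" "B ` Y \<subseteq> Pow {..<d}" unfolding A_def B_def by auto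
  have r: "card (row_trace M Y ` X) \<le> card (A ` X)"
    by (rule card_image_le_factor[OF fin(1)]) (auto simp: row_trace_def iff)
  have c: "card (row_trace (mtransp M) X ` Y) \<le> card (B ` Y)"
    by (rule card_image_le_factor[OF fin(2)]) (auto simp: row_trace_def iff)
  have "card (A ` X) * card (B ` Y) \<le> choose_le (card {..<d}) s * 2 ^ card {..<d}"
    by (rule sgall_bound[OF _ sub]) (use meet in auto)
  then show "card (row_trace M Y ` X) * card (row_trace (mtransp M) X ` Y) \<le> choose_le d s * 2 ^ d"
    using mult_le_mono[OF r c] by simp
  have P: "card (Pow {..<d}) = 2 ^ d" by (simp add: card_Pow)
  show "card (row_trace M Y ` X) \<le> 2 ^ d"
    using r card_mono[OF _ sub(1)] P by simp
  show "card (row_trace (mtransp M) X ` Y) \<le> 2 ^ d"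
    using c card_mono[OF _ sub(2)] P by simp
qed

text \<open>Empty rectangles pad a cover without changing any multiplicity.\<close>

lemma s_cover_mono:
  assumes "s_cover s n m M d" "d \<le> e"
  shows "s_cover s n m M e"
proof -
  obtain I J where "s_cover_by s n m M d I J"
    using assms(1) unfolding s_cover_iff by blast
  note c = s_cover_byD[OF this]
  have eq': "{k. k < e \<and> i \<in> (if k < d then I k else {}) \<and> j \<in> (if k < d then J k else {})}
    = {k. k < d \<and> i \<in> I k \<and> j \<in> J k}" for i j
    using assms(2) by auto
  show ?thesis
  proof (rule s_coverI[of e "\<lambda>k. if k < d then I k else {}" n "\<lambda>k. if k < d then J k else {}"])
    show "M i j" if "i \<in> (if k < d then I k else {})" "j \<in> (if k < d then J k else {})" for k i j
      using that c(3) by (auto split: if_splits)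
  qed (use c(1,2,4) eq' in simp_all)
qed

lemma s_cover_transpose:
  assumes "s_cover s n m M d"
  shows "s_cover s m n (mtransp M) d"
proof -
  obtain I J where "s_cover_by s n m M d I J"
    using assms(1) unfolding s_cover_iff by blast
  note c = s_cover_byD[OF this]
  have eq: "{k. k < d \<and> j \<in> J k \<and> i \<in> I k} = {k. k < d \<and> i \<in> I k \<and> j \<in> J k}" for i j by auto
  show ?thesis
    by (rule s_coverI[of d J m I n]) (use c in \<open>simp_all add: eq\<close>)
qed

text \<open>One rectangle per row, formed by the ones of that row. Rectangles are counted from 0 and
  rows from 1, hence \<open>Suc k\<close>.\<close>

lemma s_cover_rows:
  assumes "s \<ge> 1"
  shows "s_cover s n m M n"
proof (rule s_coverI[of n "\<lambda>k. {Suc k}" n "\<lambda>k. {j \<in> {1..m}. M (Suc k) j}"])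
  fix i j assume ij: "i \<in> {1..n}" "j \<in> {1..m}" "M i j"
  then have "{k. k < n \<and> i \<in> {Suc k} \<and> j \<in> {j \<in> {1..m}. M (Suc k) j}} = {i - 1}" by auto
  then show "1 \<le> card {k. k < n \<and> i \<in> {Suc k} \<and> j \<in> {j \<in> {1..m}. M (Suc k) j}} \<and>
     card {k. k < n \<and> i \<in> {Suc k} \<and> j \<in> {j \<in> {1..m}. M (Suc k) j}} \<le> s"
    using assms by simp
qed auto

lemma s_cover_cols:
  assumes "s \<ge> 1"
  shows "s_cover s n m M m"
  using s_cover_transpose[OF s_cover_rows[OF assms, of m n "mtransp M"]] by simp

text \<open>The \<open>LEAST\<close> is attained because the cover by single rows exists; padding
  then gives every larger \<open>d\<close>.\<close>

lemma s_binary_rank_le_iff: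
  assumes "s \<ge> 1"
  shows "s_binary_rank s n m M \<le> d \<longleftrightarrow> s_cover s n m M d"
proof
  have "s_cover s n m M (s_binary_rank s n m M)"
    unfolding s_binary_rank_def by (rule LeastI[of _ n]) (rule s_cover_rows[OF assms])
  then show "s_cover s n m M d" if "s_binary_rank s n m M \<le> d"
    using that by (rule s_cover_mono)
  show "s_binary_rank s n m M \<le> d" if "s_cover s n m M d"
    unfolding s_binary_rank_def using that by (rule Least_le)
qed

lemma s_binary_rank_transpose:
  assumes "s \<ge> 1"
  shows "s_binary_rank s m n (mtransp M) = s_binary_rank s n m M"
  using s_binary_rank_le_iff[OF assms] s_cover_transpose[of s n m M] s_cover_transpose[of s m n "mtransp M"]
  by (meson order_antisym order_refl)

text \<open>Preimages of the rectangles cover the new matrix with the same multiplicities. Hence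
  repeating rows and columns, or setting some to zero, costs no rank.\<close>

lemma s_cover_pullback:
  assumes "s_cover s n m M d"
    and "A \<subseteq> {1..n}" "B \<subseteq> {1..m}" "f ` A \<subseteq> {1..n}" "g ` B \<subseteq> {1..m}"
  shows "s_cover s n m (\<lambda>i j. i \<in> A \<and> j \<in> B \<and> M (f i) (g j)) d"
proof -
  obtain I J where "s_cover_by s n m M d I J"
    using assms(1) unfolding s_cover_iff by blast
  note c = s_cover_byD[OF this]
  show ?thesis
  proof (rule s_coverI[of d "\<lambda>k. {i \<in> A. f i \<in> I k}" n "\<lambda>k. {j \<in> B. g j \<in> J k}"])
    fix i j assume "i \<in> A \<and> j \<in> B \<and> M (f i) (g j)"
    moreover from this have "f i \<in> {1..n}" "g j \<in> {1..m}" using assms by blast+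
    ultimately show "1 \<le> card {k. k < d \<and> i \<in> {i \<in> A. f i \<in> I k} \<and> j \<in> {j \<in> B. g j \<in> J k}} \<and>
       card {k. k < d \<and> i \<in> {i \<in> A. f i \<in> I k} \<and> j \<in> {j \<in> B. g j \<in> J k}} \<le> s"
      using c(4)[of "f i" "g j"] by simp
  qed (use assms(2,3) c(3) in auto)
qed

text \<open>Row \<open>r\<close> is cut out of all old rectangles and covered by a new one, with
  index \<open>d\<close>; multiplicities in the other rows are unchanged.\<close>

lemma s_cover_replace_row:
  assumes "s \<ge> 1" "s_cover s n m M d"
    and eq: "\<And>i j. i \<noteq> r \<Longrightarrow> M' i j = M i j"
  shows "s_cover s n m M' (Suc d)"
proof -
  obtain I J where "s_cover_by s n m M d I J"
    using assms(2) unfolding s_cover_iff by blast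
  note c = s_cover_byD[OF this]
  let ?I = "\<lambda>k. if k < d then I k - {r} else {r} \<inter> {1..n}"
  let ?J = "\<lambda>k. if k < d then J k else {j \<in> {1..m}. M' r j}"
  show ?thesis
  proof (rule s_coverI[of "Suc d" ?I n ?J])
    fix i j assume ij: "i \<in> {1..n}" "j \<in> {1..m}" "M' i j"
    show "1 \<le> card {k. k < Suc d \<and> i \<in> ?I k \<and> j \<in> ?J k} \<and> card {k. k < Suc d \<and> i \<in> ?I k \<and> j \<in> ?J k} \<le> s"
    proof (cases "i = r")
      case True
      then have "{k. k < Suc d \<and> i \<in> ?I k \<and> j \<in> ?J k} = {d}" using ij by (auto split: if_splits)
      then show ?thesis using assms(1) by simp
    next
      case False
      then have "{k. k < Suc d \<and> i \<in> ?I k \<and> j \<in> ?J k} = {k. k < d \<and> i \<in> I k \<and> j \<in> J k}"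
        by (auto split: if_splits)
      then show ?thesis using c(4)[OF ij(1,2)] ij(3) eq[OF False] by simp
    qed
  next
    fix k i j assume "k < Suc d" "i \<in> ?I k" "j \<in> ?J k"
    then show "M' i j" using c(3)[of k i j] eq[of i j] by (cases "k < d") auto
  qed (use c(1,2) in \<open>auto split: if_splits\<close>)
qed

text \<open>The diagonal entries \<open>(i, i)\<close> with \<open>i \<in> {1..d}\<close> form a
  fooling set: a rectangle with two of them would contain an off-diagonal entry, which is
  zero.\<close>

lemma s_cover_unit_rows_ge:
  assumes "s_cover s n m M e" "d \<le> n" "d \<le> m"
    and unit: "\<And>i j. i \<in> {1..d} \<Longrightarrow> M i j \<longleftrightarrow> i = j"
  shows "d \<le> e"
proof -
  obtain I J where "s_cover_by s n m M e I J"
    using assms(1) unfolding s_cover_iff by blast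
  note c = s_cover_byD[OF this]
  have "\<exists>k. k < e \<and> i \<in> I k \<and> i \<in> J k" if "i \<in> {1..d}" for i
  proof -
    have "1 \<le> card {k. k < e \<and> i \<in> I k \<and> i \<in> J k}"
      using that assms(2,3) unit[OF that, of i] c(4)[of i i] by auto
    then have "{k. k < e \<and> i \<in> I k \<and> i \<in> J k} \<noteq> {}" by force
    then show ?thesis by blast
  qed
  then obtain h where h: "\<And>i. i \<in> {1..d} \<Longrightarrow> h i < e \<and> i \<in> I (h i) \<and> i \<in> J (h i)" by metis
  have "inj_on h {1..d}"
  proof (rule inj_onI)
    fix i i' assume ii: "i \<in> {1..d}" "i' \<in> {1..d}" "h i = h i'"
    then have "M i i'" using h[OF ii(1)] h[OF ii(2)] c(3)[of "h i" i i'] by simp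
    then show "i = i'" using unit[OF ii(1)] by simp
  qed
  moreover have "h ` {1..d} \<subseteq> {..<e}" using h by auto
  ultimately show ?thesis using card_inj_on_le[of h "{1..d}" "{..<e}"] by simp
qed

section \<open>Distance between matrices, and matrices of exact rank nearby\<close>

lemma finite_mdist: "finite {(i, j). i \<in> {1..n} \<and> j \<in> {1..m} \<and> P i j}" for n m :: nat
  by (rule finite_subset[of _ "{1..n} \<times> {1..m}"]) auto

lemma mdist_triangle: "mdist n m M M'' \<le> mdist n m M M' + mdist n m M' M''"
proof -
  have "mdist n m M M'' \<le> card ({(i,j). i \<in> {1..n} \<and> j \<in> {1..m} \<and> M i j \<noteq> M' i j} \<union>
      {(i,j). i \<in> {1..n} \<and> j \<in> {1..m} \<and> M' i j \<noteq> M'' i j})"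
    unfolding mdist_def by (intro card_mono finite_UnI finite_mdist) auto
  also have "\<dots> \<le> mdist n m M M' + mdist n m M' M''"
    unfolding mdist_def by (rule card_Un_le)
  finally show ?thesis .
qed

lemma mdist_transpose: "mdist m n (mtransp M) (mtransp M') = mdist n m M M'"
proof -
  have "{(i, j). i \<in> {1..m} \<and> j \<in> {1..n} \<and> M j i \<noteq> M' j i}
    = prod.swap ` {(i,j). i \<in> {1..n} \<and> j \<in> {1..m} \<and> M i j \<noteq> M' i j}" by auto
  then show ?thesis unfolding mdist_def by (simp add: card_image inj_on_def)
qed

text \<open>Replacing the first \<open>d\<close> rows one after another by unit vectors changes the rank by at most 1
  in each step and ends at rank at least \<open>d\<close>.\<close>

lemma exact_rank_nearby:
  assumes s: "s \<ge> 1" and rk: "s_binary_rank s n m M \<le> d" and "d \<le> n" "d \<le> m"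
  shows "\<exists>M'. s_binary_rank s n m M' = d \<and> mdist n m M M' \<le> d * m"
proof -
  define N where "N = (\<lambda>l i j. if i \<in> {1..l} then i = j else M i j)"
  have N0: "N 0 = M" unfolding N_def by auto
  have step: "s_binary_rank s n m (N (Suc l)) \<le> Suc (s_binary_rank s n m (N l))" for l
    unfolding s_binary_rank_le_iff[OF s]
    by (rule s_cover_replace_row[OF s, of n m "N l" _ "Suc l"])
       (auto simp: N_def s_binary_rank_le_iff[OF s, symmetric])
  have top: "d \<le> s_binary_rank s n m (N d)"
    by (rule s_cover_unit_rows_ge[of s n m "N d" _ d])
       (use assms in \<open>auto simp: N_def s_binary_rank_le_iff[OF s, symmetric]\<close>)
  \<comment> \<open>A discrete intermediate value argument: at the first \<open>l\<close> that
    reaches rank \<open>d\<close> the rank cannot overshoot, since the stage before is below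
    \<open>d\<close> and a step adds at most 1.\<close>
  define l where "l = (LEAST l. d \<le> s_binary_rank s n m (N l))"
  have l: "d \<le> s_binary_rank s n m (N l)" unfolding l_def by (rule LeastI[of _ d]) (rule top)
  have ld: "l \<le> d" unfolding l_def by (rule Least_le) (rule top)
  have "s_binary_rank s n m (N l) \<le> d"
  proof (cases l)
    case 0
    then show ?thesis using rk N0 by simp
  next
    case (Suc l')
    then have "\<not> d \<le> s_binary_rank s n m (N l')" unfolding l_def by (metis lessI not_less_Least)
    then show ?thesis using step[of l'] Suc by simp
  qed
  then have eq: "s_binary_rank s n m (N l) = d" using l by simp
  have "mdist n m M (N l) \<le> card ({1..d} \<times> {1..m})"
    unfolding mdist_def by (rule card_mono) (use ld in \<open>auto simp: N_def split: if_splits\<close>)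
  then show ?thesis using eq by auto
qed

section \<open>Samples that represent the whole matrix\<close>

lemma measure_uniform_less_imp_card:
  assumes "n > 0" "\<not> \<delta> \<le> measure_pmf.prob (pmf_of_set {1..n::nat}) {i. P i}"
  shows "real (card {i \<in> {1..n}. P i}) \<le> \<delta> * real n"
proof -
  have "{1..n} \<inter> {i. P i} = {i \<in> {1..n}. P i}" by auto
  then have "real (card {i \<in> {1..n}. P i}) / real n < \<delta>"
    using assms by (simp add: measure_pmf_of_set)
  then show ?thesis using assms(1) by (simp add: field_simps)
qed

definition unseen_rows :: "nat \<Rightarrow> real \<Rightarrow> bmatrix \<Rightarrow> nat set \<Rightarrow> nat set \<Rightarrow> bool" where
  "unseen_rows n \<delta> M X Y \<longleftrightarrow>
     \<delta> \<le> measure_pmf.prob (pmf_of_set {1..n}) {i. row_trace M Y i \<notin> row_trace M Y ` X}"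

text \<open>A single bad partner in \<open>Y\<close> suffices, because the reconstruction picks the
  partner of \<open>j\<close> by an unspecified choice.\<close>

definition confusable :: "nat \<Rightarrow> real \<Rightarrow> bmatrix \<Rightarrow> nat set \<Rightarrow> nat set \<Rightarrow> nat \<Rightarrow> bool" where
  "confusable n \<delta> M X Y j \<longleftrightarrow>
     (\<exists>y\<in>Y. row_trace (mtransp M) X j = row_trace (mtransp M) X y \<and>
            \<delta> \<le> measure_pmf.prob (pmf_of_set {1..n}) {i. M i j \<noteq> M i y})"

definition many_confusable :: "nat \<Rightarrow> nat \<Rightarrow> real \<Rightarrow> bmatrix \<Rightarrow> nat set \<Rightarrow> nat set \<Rightarrow> bool" where
  "many_confusable n m \<delta> M X Y \<longleftrightarrow>
     \<delta> \<le> measure_pmf.prob (pmf_of_set {1..m}) {j. confusable n \<delta> M X Y j}"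

text \<open>The sampled submatrix is blown up to the whole matrix by replacing each row and each column
  by a sampled one with the same trace; the rows and columns without such a partner become zero.\<close>

lemma close_of_representative_sample:
  assumes nm: "n > 0" "m > 0" and X: "X \<subseteq> {1..n}" and Y: "Y \<subseteq> {1..m}"
    and cov: "s_cover s n m N d" and agree: "\<And>i j. i \<in> X \<Longrightarrow> j \<in> Y \<Longrightarrow> N i j = M i j"
    and R: "\<not> unseen_rows n \<delta> M X Y" and C: "\<not> unseen_rows m \<delta> (mtransp M) Y X"
    and G: "\<not> many_confusable n m \<delta> M X Y"
  shows "\<exists>M'. s_cover s n m M' d \<and> real (mdist n m M M') \<le> 4 * \<delta> * real n * real m"
proof -
  let ?r = "row_trace M Y" and ?c = "row_trace (mtransp M) X"
  define U where "U = {i \<in> {1..n}. ?r i \<notin> ?r ` X}"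
  define V where "V = {j \<in> {1..m}. ?c j \<notin> ?c ` Y}"
  define W where "W = {j \<in> {1..m}. confusable n \<delta> M X Y j}"
  have U: "real (card U) \<le> \<delta> * real n"
    using measure_uniform_less_imp_card[OF nm(1) R[unfolded unseen_rows_def]] unfolding U_def .
  have V: "real (card V) \<le> \<delta> * real m"
    using measure_uniform_less_imp_card[OF nm(2) C[unfolded unseen_rows_def]] unfolding V_def .
  have W: "real (card W) \<le> \<delta> * real m"
    using measure_uniform_less_imp_card[OF nm(2) G[unfolded many_confusable_def]] unfolding W_def .
  define A where "A = {1..n} - U"
  define B where "B = {1..m} - V"
  define f where "f = (\<lambda>i. inv_into X ?r (?r i))"
  define g where "g = (\<lambda>j. inv_into Y ?c (?c j))"
  have "?r i \<in> ?r ` X" if "i \<in> A" for i using that unfolding A_def U_def by blast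
  then have f: "f i \<in> X" "?r (f i) = ?r i" if "i \<in> A" for i
    using that unfolding f_def by (simp_all add: inv_into_into f_inv_into_f)
  have "?c j \<in> ?c ` Y" if "j \<in> B" for j using that unfolding B_def V_def by blast
  then have g: "g j \<in> Y" "?c (g j) = ?c j" if "j \<in> B" for j
    using that unfolding g_def by (simp_all add: inv_into_into f_inv_into_f)
  define M' where "M' = (\<lambda>i j. i \<in> A \<and> j \<in> B \<and> N (f i) (g j))"
  have cov': "s_cover s n m M' d"
    unfolding M'_def by (rule s_cover_pullback[OF cov]) (use f g X Y in \<open>auto simp: A_def B_def\<close>)
  \<comment> \<open>Replacing row \<open>i\<close> by \<open>f i\<close> is free here, since the two
    agree on \<open>Y\<close> and \<open>g j\<close> lies in \<open>Y\<close>. Only the exchange of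
    column \<open>j\<close> for \<open>g j\<close> remains to be paid for.\<close>
  have M': "M' i j = M i (g j)" if "i \<in> A" "j \<in> B" for i j
  proof -
    have "M' i j = M (f i) (g j)" unfolding M'_def using that agree[OF f(1)[OF that(1)] g(1)[OF that(2)]] by simp
    also have "\<dots> = M i (g j)" using f(2)[OF that(1)] g(1)[OF that(2)] unfolding row_trace_def by blast
    finally show ?thesis .
  qed
  define Z where "Z = (SIGMA j:B - W. {i \<in> {1..n}. M i j \<noteq> M i (g j)})"
  have finZ: "finite Z" unfolding Z_def B_def by auto
  have "real (card {i \<in> {1..n}. M i j \<noteq> M i (g j)}) \<le> \<delta> * real n" if j: "j \<in> B - W" for j
  proof (rule measure_uniform_less_imp_card[OF nm(1)])
    have "\<not> confusable n \<delta> M X Y j" using j unfolding W_def B_def by auto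
    then show "\<not> \<delta> \<le> measure_pmf.prob (pmf_of_set {1..n}) {i. M i j \<noteq> M i (g j)}"
      unfolding confusable_def using g[of j] j by auto
  qed
  then have "(\<Sum>j\<in>B - W. real (card {i \<in> {1..n}. M i j \<noteq> M i (g j)})) \<le> real (card (B - W)) * (\<delta> * real n)"
    by (rule sum_bounded_above)
  moreover have "real (card Z) = (\<Sum>j\<in>B - W. real (card {i \<in> {1..n}. M i j \<noteq> M i (g j)}))"
    unfolding Z_def by (subst card_SigmaI) (auto simp: B_def)
  ultimately have "real (card Z) \<le> real (card (B - W)) * (\<delta> * real n)" by simp
  also have "\<dots> \<le> real m * (\<delta> * real n)"
  proof (rule mult_right_mono)
    have "card (B - W) \<le> card {1..m}" by (rule card_mono) (auto simp: B_def)
    then show "real (card (B - W)) \<le> real m" by simp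
    show "0 \<le> \<delta> * real n" using U by (rule order_trans[rotated]) simp
  qed
  finally have Z: "real (card Z) \<le> \<delta> * real n * real m" by (simp add: mult_ac)
  \<comment> \<open>Four sources of error, each at most \<open>\<delta> * n * m\<close>: unseen
    rows, unseen columns, confusable columns, and the remaining differences between a column and its
    partner. \<open>Z\<close> lists the column first, hence the swap.\<close>
  have "{(i, j). i \<in> {1..n} \<and> j \<in> {1..m} \<and> M i j \<noteq> M' i j}
      \<subseteq> U \<times> {1..m} \<union> {1..n} \<times> V \<union> {1..n} \<times> W \<union> prod.swap ` Z"
  proof
    fix p assume "p \<in> {(i, j). i \<in> {1..n} \<and> j \<in> {1..m} \<and> M i j \<noteq> M' i j}"
    then obtain i j where p: "p = (i, j)" "i \<in> {1..n}" "j \<in> {1..m}" "M i j \<noteq> M' i j" by auto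
    show "p \<in> U \<times> {1..m} \<union> {1..n} \<times> V \<union> {1..n} \<times> W \<union> prod.swap ` Z"
    proof (cases "i \<in> A \<and> j \<in> B - W")
      case True
      then have "(j, i) \<in> Z" using p M'[of i j] unfolding Z_def by auto
      then show ?thesis using p by force
    next
      case False
      then show ?thesis using p unfolding A_def B_def by auto
    qed
  qed
  then have "mdist n m M M' \<le> card (U \<times> {1..m} \<union> {1..n} \<times> V \<union> {1..n} \<times> W \<union> prod.swap ` Z)"
    unfolding mdist_def by (rule card_mono[rotated]) (use finZ in \<open>auto simp: U_def V_def W_def\<close>)
  also have "\<dots> \<le> card (U \<times> {1..m}) + card ({1..n} \<times> V) + card ({1..n} \<times> W) + card (prod.swap ` Z)"
    by (intro order_trans[OF card_Un_le] add_mono card_Un_le order_refl)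
  also have "\<dots> = card U * m + n * card V + n * card W + card Z"
    by (simp add: card_cartesian_product card_image)
  finally have "real (mdist n m M M') \<le> real (card U * m + n * card V + n * card W + card Z)"
    by (simp only: of_nat_le_iff)
  also have "\<dots> \<le> \<delta> * real n * real m + real n * (\<delta> * real m) + real n * (\<delta> * real m) + \<delta> * real n * real m"
    unfolding of_nat_add of_nat_mult
    by (intro add_mono mult_left_mono mult_right_mono U V W Z) auto
  also have "\<dots> = 4 * \<delta> * real n * real m" by (simp add: algebra_simps)
  finally show ?thesis using cov' by blast
qed

lemma unseen_rows_prob:
  assumes "0 \<le> \<delta>" "\<delta> \<le> 1"
  shows "measure_pmf.prob (replicate_pmf t (pmf_of_set {1..n}))
      {xs. unseen_rows n \<delta> M (set xs) Y \<and> card (row_trace M Y ` set xs) \<le> k} \<le> 2 ^ k * (1 - \<delta> / 2) ^ t"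
  using unseen_mass_bound[OF assms, of t "pmf_of_set {1..n}" "row_trace M Y" "{}" k]
  unfolding unseen_rows_def by simp

text \<open>A column \<open>y\<close> that differs from \<open>j\<close> on mass
  \<open>\<delta>\<close> shares its trace only if the sampled rows miss the whole difference set. A
  union bound over \<open>Y\<close> handles a fixed \<open>j\<close>, and Markov's inequality passes
  to the mass of such \<open>j\<close>.\<close>

lemma many_confusable_prob:
  assumes "0 < \<delta>" "\<delta> \<le> 1" "finite Y"
  shows "measure_pmf.prob (replicate_pmf t (pmf_of_set {1..n})) {xs. many_confusable n m \<delta> M (set xs) Y}
     \<le> real (card Y) * (1 - \<delta>) ^ t / \<delta>"
  unfolding many_confusable_def
proof (rule measure_section_ge_le)
  let ?p = "pmf_of_set {1..n}"
  fix j
  define Y' where "Y' = {y \<in> Y. \<delta> \<le> measure_pmf.prob ?p {i. M i j \<noteq> M i y}}"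
  have "measure_pmf.prob (replicate_pmf t ?p) {xs. confusable n \<delta> M (set xs) Y j}
    \<le> measure_pmf.prob (replicate_pmf t ?p) (\<Union>y\<in>Y'. {xs. set xs \<inter> {i. M i j \<noteq> M i y} = {}})"
    by (rule measure_pmf.finite_measure_mono) (auto simp: confusable_def row_trace_def Y'_def)
  also have "\<dots> \<le> (\<Sum>y\<in>Y'. measure_pmf.prob (replicate_pmf t ?p) {xs. set xs \<inter> {i. M i j \<noteq> M i y} = {}})"
    by (rule measure_pmf.finite_measure_subadditive_finite) (use assms(3) in \<open>auto simp: Y'_def\<close>)
  also have "\<dots> \<le> real (card Y') * (1 - \<delta>) ^ t"
    by (rule sum_bounded_above, rule miss_prob_le) (use assms in \<open>auto simp: Y'_def\<close>)
  also have "\<dots> \<le> real (card Y) * (1 - \<delta>) ^ t"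
  proof (rule mult_right_mono)
    have "card Y' \<le> card Y" by (rule card_mono) (use assms(3) in \<open>auto simp: Y'_def\<close>)
    then show "real (card Y') \<le> real (card Y)" by simp
  qed (use assms in simp)
  finally show "measure_pmf.prob (replicate_pmf t ?p) {xs. confusable n \<delta> M (set xs) Y j}
    \<le> real (card Y) * (1 - \<delta>) ^ t" .
qed (rule assms)

section \<open>The staircase of scales\<close>

text \<open>At scale 0 the bound \<open>c0\<close> excludes the column alternative. The row
  alternative then propagates upwards, since together with the column alternative one scale later it
  would break the product bound; at scale \<open>d\<close> it contradicts \<open>rd\<close>.\<close>

lemma no_staircase:
  fixes r c :: "nat \<Rightarrow> nat"
  assumes "K \<ge> 1" and big: "\<And>i. i \<le> d \<Longrightarrow> 2 ^ i < r i \<or> K * 2 ^ (d + 1 - i) < c i"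
    and c0: "c 0 \<le> 2 ^ d" and rd: "r d \<le> 2 ^ d"
    and prod: "\<And>i. i < d \<Longrightarrow> r i * c (Suc i) \<le> K * 2 ^ d"
  shows False
proof -
  have "2 ^ i < r i" if "i \<le> d" for i
    using that
  proof (induction i)
    case 0
    have "(2::nat) ^ d \<le> K * 2 ^ (d + 1)" using assms(1) by (simp add: Suc_leI trans_le_add1)
    then have "\<not> K * 2 ^ (d + 1 - 0) < c 0" using c0 by (simp only: diff_zero)
    then show ?case using big[of 0] by simp
  next
    case (Suc i)
    have "\<not> K * 2 ^ (d + 1 - Suc i) < c (Suc i)"
    proof
      assume "K * 2 ^ (d + 1 - Suc i) < c (Suc i)"
      moreover have "2 ^ i < r i" using Suc by simp
      ultimately have "2 ^ i * (K * 2 ^ (d + 1 - Suc i)) < r i * c (Suc i)"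
        by (intro mult_strict_mono) auto
      \<comment> \<open>The 1 in the exponent of the column threshold compensates the shift from
        \<open>i\<close> to \<open>Suc i\<close>.\<close>
      moreover have "2 ^ i * (K * 2 ^ (d + 1 - Suc i)) = K * 2 ^ d"
        using Suc.prems by (simp add: mult.left_commute flip: power_add)
      ultimately show False using prod[OF Suc_le_lessD[OF Suc.prems]] by (simp only: leD)
    qed
    then show ?case using big[OF Suc.prems] by blast
  qed
  then show False using rd by (metis leD order_refl)
qed

lemma row_trace_cong:
  "(\<And>j. j \<in> Y \<Longrightarrow> M i j = N i j) \<Longrightarrow> row_trace M Y i = row_trace N Y i"
  unfolding row_trace_def by auto

text \<open>If no close matrix exists, no scale gives a representative sample, so the excluded
  events leave at each scale too many row traces or too many column traces. The trace bounds of
  \<open>N\<close> hold for \<open>M\<close> on the queried blocks and contradict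
  \<open>no_staircase\<close>.\<close>

lemma staircase_sample_close:
  fixes X Y :: "nat \<Rightarrow> nat set"
  assumes nm: "n > 0" "m > 0"
    and X: "\<And>i. X i \<subseteq> {1..n}" "\<And>i. X i \<subseteq> X (Suc i)"
    and Y: "\<And>i. Y i \<subseteq> {1..m}" "\<And>i. Y (Suc i) \<subseteq> Y i"
    and cov: "s_cover s n m N d"
    and agree: "\<And>k i j. k \<le> d \<Longrightarrow> i \<in> X (Suc k) \<Longrightarrow> j \<in> Y k \<Longrightarrow> N i j = M i j"
    and R: "\<And>k. k \<le> d \<Longrightarrow>
      \<not> (unseen_rows n \<delta> M (X k) (Y k) \<and> card (row_trace M (Y k) ` X k) \<le> 2 ^ k)"
    and C: "\<And>k. k \<le> d \<Longrightarrow>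
      \<not> (unseen_rows m \<delta> (mtransp M) (Y k) (X k) \<and>
         card (row_trace (mtransp M) (X k) ` Y k) \<le> choose_le d s * 2 ^ (d + 1 - k))"
    and G: "\<And>k. k \<le> d \<Longrightarrow> \<not> many_confusable n m \<delta> M (X k) (Y k)"
  shows "\<exists>M'. s_cover s n m M' d \<and> real (mdist n m M M') \<le> 4 * \<delta> * real n * real m"
proof (rule ccontr)
  assume far: "\<not> ?thesis"
  let ?r = "\<lambda>k. card (row_trace M (Y k) ` X k)" and ?c = "\<lambda>k. card (row_trace (mtransp M) (X k) ` Y k)"
  have fin: "finite (X k)" "finite (Y k)" for k
    using X(1)[of k] Y(1)[of k] by (auto intro: finite_subset)
  have agree': "N i j = M i j" if "k \<le> d" "i \<in> X k" "j \<in> Y k" for k i j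
    using agree[OF that(1) _ that(3)] X(2)[of k] that(2) by blast
  have bound: "card (row_trace M B ` A) * card (row_trace (mtransp M) A ` B) \<le> choose_le d s * 2 ^ d"
    "card (row_trace M B ` A) \<le> 2 ^ d" "card (row_trace (mtransp M) A ` B) \<le> 2 ^ d"
    if A: "A \<subseteq> {1..n}" and B: "B \<subseteq> {1..m}" and "\<And>i j. i \<in> A \<Longrightarrow> j \<in> B \<Longrightarrow> N i j = M i j" for A B
  proof -
    have "row_trace M B ` A = row_trace N B ` A" "row_trace (mtransp M) A ` B = row_trace (mtransp N) A ` B"
      using that(3) by (auto intro!: image_cong row_trace_cong)
    then show "card (row_trace M B ` A) * card (row_trace (mtransp M) A ` B) \<le> choose_le d s * 2 ^ d"
      "card (row_trace M B ` A) \<le> 2 ^ d" "card (row_trace (mtransp M) A ` B) \<le> 2 ^ d"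
      using s_cover_traces[OF cov A B] by simp_all
  qed
  show False
  proof (rule no_staircase[of "choose_le d s" d ?r ?c])
    have "(d choose 0) \<le> choose_le d s"
      unfolding choose_le_def by (rule member_le_sum) auto
    then show "1 \<le> choose_le d s" by simp
    show "?c 0 \<le> 2 ^ d" by (rule bound(3)[OF X(1) Y(1) agree'[of 0]]) simp_all
    show "?r d \<le> 2 ^ d" by (rule bound(2)[OF X(1) Y(1) agree'[of d]]) simp_all
    show "2 ^ k < ?r k \<or> choose_le d s * 2 ^ (d + 1 - k) < ?c k" if k: "k \<le> d" for k
    proof (rule ccontr)
      assume "\<not> ?thesis"
      then have "?r k \<le> 2 ^ k" "?c k \<le> choose_le d s * 2 ^ (d + 1 - k)" by auto
      then have "\<not> unseen_rows n \<delta> M (X k) (Y k)" "\<not> unseen_rows m \<delta> (mtransp M) (Y k) (X k)"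
        using R[OF k] C[OF k] by blast+
      then show False
        using close_of_representative_sample[OF nm X(1) Y(1) cov agree'[OF k] _ _ G[OF k]] far by blast
    qed
    \<comment> \<open>Row traces at \<open>k\<close> and column traces at \<open>Suc k\<close> are
      both counted in the block of \<open>X (Suc k)\<close> and \<open>Y k\<close>. This is why rows
      are queried one scale ahead of columns.\<close>
    show "?r k * ?c (Suc k) \<le> choose_le d s * 2 ^ d" if k: "k < d" for k
    proof -
      have "?r k * ?c (Suc k) \<le> card (row_trace M (Y k) ` X (Suc k)) * card (row_trace (mtransp M) (X (Suc k)) ` Y k)"
        by (intro mult_le_mono card_mono image_mono finite_imageI fin X(2) Y(2))
      also have "\<dots> \<le> choose_le d s * 2 ^ d"
        by (rule bound(1)[OF X(1) Y(1) agree[OF less_imp_le[OF k]]])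
      finally show ?thesis .
    qed
  qed
qed

section \<open>Testers that look for a consistent matrix\<close>

text \<open>Accepting iff some matrix with the property fits the answers makes the error one-sided,
  since a matrix with the property is its own witness. Only soundness is left as an
  assumption.\<close>

lemma consistency_tester:
  assumes Q: "\<And>w. w \<in> set_pmf W \<Longrightarrow> Q w \<subseteq> {1..n} \<times> {1..m} \<and> real (card (Q w)) \<le> qb"
    and far: "\<And>M. eps_far n m P eps M \<Longrightarrow>
      measure_pmf.prob W {w. \<exists>N. P N \<and> (\<forall>(i, j)\<in>Q w. N i j = M i j)} \<le> 1/3"
  shows "\<exists>T. nonadaptive_one_sided_tester n m P eps qb T"
proof -
  define D where "D = (\<lambda>w f. \<exists>N. P N \<and> (\<forall>(i, j)\<in>Q w. N i j = f (i, j)))"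
  define T where "T = map_pmf (\<lambda>w. (Q w, D w)) W"
  have acc: "accept_prob T M = measure_pmf.prob W {w. \<exists>N. P N \<and> (\<forall>(i, j)\<in>Q w. N i j = M i j)}" for M
    unfolding accept_prob_def T_def D_def by (simp add: vimage_def)
  have "D w f = D w g" if "\<forall>p\<in>Q w. f p = g p" for w f g
    unfolding D_def using that by (intro ex_cong conj_cong refl ball_cong) auto
  moreover have "accept_prob T M = 1" if "P M" for M
  proof -
    have "{w. \<exists>N. P N \<and> (\<forall>(i, j)\<in>Q w. N i j = M i j)} = UNIV" using that by blast
    then show ?thesis unfolding acc by simp
  qed
  moreover have "2/3 \<le> 1 - accept_prob T M" if "eps_far n m P eps M" for M
    unfolding acc using far[OF that] by simp
  ultimately have "nonadaptive_one_sided_tester n m P eps qb T"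
    unfolding nonadaptive_one_sided_tester_def using Q by (auto simp: T_def)
  then show ?thesis by blast
qed

text \<open>Each of the \<open>d + 1\<close> scales has three bad events, bounded by
  \<open>R\<close>, \<open>C\<close> and \<open>G\<close>; the union bound totals
  \<open>3 * (d + 1) * \<eta> \<le> 1/3\<close>.\<close>

lemma staircase_tester:
  fixes t u :: "nat \<Rightarrow> nat"
  assumes nm: "n > 0" "m > 0" and \<delta>: "0 < \<delta>" "\<delta> \<le> 1"
    and t: "mono t" and u: "antimono u"
    and R: "\<And>k. k \<le> d \<Longrightarrow> 2 ^ 2 ^ k * (1 - \<delta> / 2) ^ t k \<le> \<eta>"
    and C: "\<And>k. k \<le> d \<Longrightarrow> 2 ^ (choose_le d s * 2 ^ (d + 1 - k)) * (1 - \<delta> / 2) ^ u k \<le> \<eta>"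
    and G: "\<And>k. k \<le> d \<Longrightarrow> real (u k) * (1 - \<delta>) ^ t k / \<delta> \<le> \<eta>"
    and \<eta>: "9 * (real d + 1) * \<eta> \<le> 1"
    and qb: "(\<Sum>k\<le>d. real (t (Suc k)) * real (u k)) \<le> qb"
  shows "\<exists>T. nonadaptive_one_sided_tester n m (\<lambda>M. s_cover s n m M d) (4 * \<delta>) qb T"
proof -
  let ?p = "pmf_of_set {1..n}" and ?q = "pmf_of_set {1..m}"
  let ?P = "\<lambda>a b. pair_pmf (replicate_pmf a ?p) (replicate_pmf b ?q)"
  \<comment> \<open>The longest prefixes in use: rows run one scale ahead up to
    \<open>Suc d\<close>, and column prefixes shrink from scale 0 on.\<close>
  define W where "W = ?P (t (Suc d)) (u 0)"
  define X where "X = (\<lambda>xs i. set (take (t i) xs) :: nat set)"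
  define Y where "Y = (\<lambda>ys i. set (take (u i) ys) :: nat set)"
  define Q where "Q = (\<lambda>(xs, ys). \<Union>k\<le>d. X xs (Suc k) \<times> Y ys k)"
  have lists: "set xs \<subseteq> {1..n}" "set ys \<subseteq> {1..m}" if "(xs, ys) \<in> set_pmf W" for xs ys
    using that nm unfolding W_def by (auto simp: set_replicate_pmf)
  have XY: "X xs i \<subseteq> {1..n}" "Y ys i \<subseteq> {1..m}" if "(xs, ys) \<in> set_pmf W" for xs ys i
    using lists[OF that] set_take_subset[of "t i" xs] set_take_subset[of "u i" ys] unfolding X_def Y_def by blast+
  show ?thesis
  proof (rule consistency_tester[of W Q])
    fix w assume w: "w \<in> set_pmf W"
    obtain xs ys where w': "w = (xs, ys)" by fastforce
    have "card (Q w) \<le> (\<Sum>k\<le>d. card (X xs (Suc k) \<times> Y ys k))"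
      unfolding Q_def w' by (simp add: card_UN_le)
    also have "\<dots> \<le> (\<Sum>k\<le>d. t (Suc k) * u k)"
      unfolding card_cartesian_product X_def Y_def
      by (intro sum_mono mult_le_mono order_trans[OF card_length]) auto
    finally have "real (card (Q w)) \<le> real (\<Sum>k\<le>d. t (Suc k) * u k)" by (simp only: of_nat_le_iff)
    also have "\<dots> \<le> qb" using qb by simp
    finally show "Q w \<subseteq> {1..n} \<times> {1..m} \<and> real (card (Q w)) \<le> qb"
      using XY w unfolding Q_def w' by fastforce
  next
    fix M assume far: "eps_far n m (\<lambda>M. s_cover s n m M d) (4 * \<delta>) M"
    define ER where "ER = (\<lambda>k xs ys. unseen_rows n \<delta> M (set xs) (set ys) \<and> card (row_trace M (set ys) ` set xs) \<le> 2 ^ k)"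
    define EC where "EC = (\<lambda>k xs ys. unseen_rows m \<delta> (mtransp M) (set ys) (set xs) \<and>
        card (row_trace (mtransp M) (set xs) ` set ys) \<le> choose_le d s * 2 ^ (d + 1 - k))"
    define EG where "EG = (\<lambda>xs ys. many_confusable n m \<delta> M (set xs) (set ys))"
    define E where "E = (\<lambda>k. {(xs, ys). ER k (take (t k) xs) (take (u k) ys)} \<union>
        {(xs, ys). EC k (take (t k) xs) (take (u k) ys)} \<union> {(xs, ys). EG (take (t k) xs) (take (u k) ys)})"
    have Ek: "measure_pmf.prob W (E k) \<le> 3 * \<eta>" if k: "k \<le> d" for k
    proof -
      have le: "t k \<le> t (Suc d)" "u k \<le> u 0" using t u k by (auto simp: mono_def antimono_def)
      \<comment> \<open>The row event is bounded for fixed columns, the column event for fixed rows,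
        and the confusable event again for fixed columns.\<close>
      have 1: "measure_pmf.prob W {(xs, ys). ER k (take (t k) xs) (take (u k) ys)} \<le> \<eta>"
        unfolding W_def measure_pair_replicate_take[OF le]
        by (rule measure_pair_pmf_le_snd, unfold ER_def, rule order_trans[OF unseen_rows_prob R]) (use \<delta> k in auto)
      have 2: "measure_pmf.prob W {(xs, ys). EC k (take (t k) xs) (take (u k) ys)} \<le> \<eta>"
        unfolding W_def measure_pair_replicate_take[OF le]
        by (rule measure_pair_pmf_le_fst, unfold EC_def, rule order_trans[OF unseen_rows_prob C]) (use \<delta> k in auto)
      have 3: "measure_pmf.prob W {(xs, ys). EG (take (t k) xs) (take (u k) ys)} \<le> \<eta>"
        unfolding W_def measure_pair_replicate_take[OF le]
      proof (rule measure_pair_pmf_le_snd)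
        fix ys assume "ys \<in> set_pmf (replicate_pmf (u k) ?q)"
        then have "card (set ys) \<le> u k" using card_length[of ys] by (simp add: set_replicate_pmf)
        then have "real (card (set ys)) * (1 - \<delta>) ^ t k / \<delta> \<le> real (u k) * (1 - \<delta>) ^ t k / \<delta>"
          using \<delta> by (intro divide_right_mono mult_right_mono) auto
        then show "measure_pmf.prob (replicate_pmf (t k) ?p) {xs. EG xs ys} \<le> \<eta>"
          unfolding EG_def using many_confusable_prob[OF \<delta>, of "set ys" "t k" n m M] G[OF k] by simp
      qed
      have "measure_pmf.prob W (E k) \<le> measure_pmf.prob W {(xs, ys). ER k (take (t k) xs) (take (u k) ys)}
        + measure_pmf.prob W {(xs, ys). EC k (take (t k) xs) (take (u k) ys)}
        + measure_pmf.prob W {(xs, ys). EG (take (t k) xs) (take (u k) ys)}"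
        unfolding E_def by (intro order_trans[OF measure_Un_le] add_mono measure_Un_le order_refl) auto
      then show ?thesis using 1 2 3 by simp
    qed
    have "{w. \<exists>N. s_cover s n m N d \<and> (\<forall>(i, j)\<in>Q w. N i j = M i j)} \<inter> set_pmf W \<subseteq> (\<Union>k\<le>d. E k)"
    proof
      fix w assume w: "w \<in> {w. \<exists>N. s_cover s n m N d \<and> (\<forall>(i, j)\<in>Q w. N i j = M i j)} \<inter> set_pmf W"
      obtain xs ys where w': "w = (xs, ys)" by fastforce
      obtain N where N: "s_cover s n m N d" "\<forall>(i, j)\<in>Q w. N i j = M i j" using w by blast
      show "w \<in> (\<Union>k\<le>d. E k)"
      proof (rule ccontr)
        assume "w \<notin> (\<Union>k\<le>d. E k)"
        then have nE: "\<not> ER k (take (t k) xs) (take (u k) ys)" "\<not> EC k (take (t k) xs) (take (u k) ys)"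
          "\<not> EG (take (t k) xs) (take (u k) ys)" if "k \<le> d" for k
          using that unfolding E_def w' by blast+
        have ag: "N i j = M i j" if "k \<le> d" "i \<in> X xs (Suc k)" "j \<in> Y ys k" for k i j
          using N(2) that unfolding Q_def w' by fastforce
        have mX: "X xs i \<subseteq> X xs (Suc i)" for i
          unfolding X_def using t by (intro set_take_subset_set_take) (simp add: mono_def)
        have mY: "Y ys (Suc i) \<subseteq> Y ys i" for i
          unfolding Y_def using u by (intro set_take_subset_set_take) (simp add: antimono_def)
        have W: "(xs, ys) \<in> set_pmf W" using w w' by simp
        have "\<exists>M'. s_cover s n m M' d \<and> real (mdist n m M M') \<le> 4 * \<delta> * real n * real m"
          by (rule staircase_sample_close[of n m "X xs" "Y ys", OF nm XY(1)[OF W] mX XY(2)[OF W] mY N(1) ag])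
             (use nE in \<open>simp_all add: ER_def EC_def EG_def X_def Y_def\<close>)
        then show False using far unfolding eps_far_def by force
      qed
    qed
    then have "measure_pmf.prob W {w. \<exists>N. s_cover s n m N d \<and> (\<forall>(i, j)\<in>Q w. N i j = M i j)}
      \<le> measure_pmf.prob W (\<Union>k\<le>d. E k)"
      by (subst measure_Int_set_pmf[symmetric]) (rule measure_pmf.finite_measure_mono, auto)
    also have "\<dots> \<le> (\<Sum>k\<le>d. measure_pmf.prob W (E k))"
      by (rule measure_pmf.finite_measure_subadditive_finite) auto
    also have "\<dots> \<le> (\<Sum>k\<le>d. 3 * \<eta>)" by (rule sum_mono) (simp add: Ek)
    also have "\<dots> \<le> 1/3" using \<eta> by (simp add: algebra_simps)
    finally show "measure_pmf.prob W {w. \<exists>N. s_cover s n m N d \<and> (\<forall>(i, j)\<in>Q w. N i j = M i j)} \<le> 1/3" .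
  qed
qed

section \<open>Choice of the parameters and the query count\<close>

lemma one_minus_power_le_exp:
  fixes x :: real
  assumes "x \<le> 1"
  shows "(1 - x) ^ N \<le> exp (- x * real N)"
proof -
  have "(1 - x) ^ N \<le> exp (- x) ^ N"
    using assms exp_ge_add_one_self[of "- x"] by (intro power_mono) auto
  also have "\<dots> = exp (real N * - x)" by (rule exp_of_nat_mult[symmetric])
  finally show ?thesis by (simp add: mult.commute)
qed

lemma two_power_le_exp: "(2::real) ^ k \<le> exp (real k)"
proof -
  have "(2::real) ^ k \<le> exp 1 ^ k" using exp_ge_add_one_self[of 1] by (intro power_mono) auto
  also have "\<dots> = exp (real k * 1)" by (rule exp_of_nat_mult[symmetric])
  finally show ?thesis by simp
qed

lemma nat_ceiling_bounds:
  fixes x :: real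
  assumes "0 \<le> x"
  shows "x \<le> real (nat \<lceil>x\<rceil>)" "real (nat \<lceil>x\<rceil>) \<le> x + 1"
  using assms by linarith+

text \<open>The terms for 0 and 1 alone sum to \<open>d + 1\<close>. This is what permits column
  prefixes without a factor \<open>ln T\<close>.\<close>

lemma choose_le_ge:
  assumes "s \<ge> 1"
  shows "d + 1 \<le> choose_le d s"
proof -
  have "(\<Sum>i\<in>{0, 1}. d choose i) \<le> choose_le d s"
    unfolding choose_le_def by (rule sum_mono2) (use assms in auto)
  then show ?thesis by simp
qed

text \<open>The first bound pays for reading a small matrix entirely; the second makes
  \<open>ln T\<close> at least 1 and \<open>1 / T\<close> a small enough failure
  probability.\<close>

lemma query_parameter_ge:
  assumes "s \<ge> 1" "d \<ge> 1" "0 < eps" "eps < 1"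
  shows "324 * real d ^ 2 / eps ^ 2 \<le> 324 * real d ^ 2 * real (choose_le d s) * 2 ^ d / eps ^ 2" (is "?a \<le> ?T")
    and "324 * real d \<le> 324 * real d ^ 2 * real (choose_le d s) * 2 ^ d / eps ^ 2"
proof -
  have "1 * 1 \<le> real (choose_le d s) * 2 ^ d"
    using choose_le_ge[OF assms(1), of d] by (intro mult_mono) auto
  then have "?a * 1 \<le> ?a * (real (choose_le d s) * 2 ^ d)"
    by (intro mult_left_mono) auto
  then show le: "?a \<le> ?T" by simp
  have "real d * 1 \<le> real d * real d" using assms(2) by (intro mult_left_mono) auto
  then have "324 * real d \<le> 324 * real d ^ 2" by (simp add: power2_eq_square)
  also have "324 * real d ^ 2 * eps ^ 2 \<le> 324 * real d ^ 2 * 1"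
    using assms(3,4) by (intro mult_left_mono) (auto simp: power_le_one)
  then have "324 * real d ^ 2 \<le> ?a" using assms(3) by (simp add: le_divide_eq)
  finally show "324 * real d \<le> ?T" using le by simp
qed

text \<open>Applies \<open>staircase_tester\<close> with \<open>\<delta> = eps / 4\<close>. Growing
  row and shrinking column prefixes balance, so each scale costs order
  \<open>K * 2 ^ d * ln T / eps ^ 2\<close>; the number \<open>d + 1\<close> of scales is absorbed
  by the \<open>d ^ 2\<close> in \<open>T\<close>.\<close>

lemma rank_at_most_tester:
  assumes s: "s \<ge> 1" and d: "d \<ge> 1" and eps: "0 < eps" "eps < 1"
    and T_def: "T = 324 * real d ^ 2 * real (choose_le d s) * 2 ^ d / eps ^ 2"
  shows "\<exists>Tst. nonadaptive_one_sided_tester n m (\<lambda>M. s_binary_rank s n m M \<le> d) eps (11 * T * ln T) Tst"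
proof -
  define K where "K = choose_le d s"
  define L where "L = ln T"
  have K: "real d + 1 \<le> real K" using choose_le_ge[OF s, of d] unfolding K_def by linarith
  have d1: "1 \<le> real d" using d by simp
  have Td: "324 * real d \<le> T" using query_parameter_ge(2)[OF s d eps] unfolding T_def .
  have T0: "T > 0" using Td d1 by linarith
  have "exp 1 \<le> T" using exp_le Td d1 by linarith
  then have L1: "1 \<le> L" unfolding L_def using T0 by (simp add: ln_ge_iff)
  have expL: "exp (- L) = 1 / T" unfolding L_def using T0 by (simp add: exp_minus inverse_eq_divide)
  define \<eta> where "\<eta> = 1 / (9 * (real d + 1))"
  have T\<eta>: "1 / T \<le> \<eta>" unfolding \<eta>_def using Td d1 by (intro divide_left_mono) auto
  \<comment> \<open>The factor 16 makes \<open>eps * t k / 8\<close> at least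
    \<open>2 * 2 ^ k * L\<close>, which dominates both the growth \<open>2 ^ k\<close> and the
    required \<open>L\<close>.\<close>
  define t where "t = (\<lambda>k. nat \<lceil>16 * 2 ^ k * L / eps\<rceil>)"
  \<comment> \<open>With \<open>l = K * 2 ^ (d + 1 - k)\<close>, the factor 24 makes
    \<open>eps * u k / 8\<close> at least \<open>3 * l\<close>: one \<open>l\<close> cancels the
    growth, and \<open>2 * l\<close> is at least \<open>4 * (d + 1)\<close>.\<close>
  define u where "u = (\<lambda>k. nat \<lceil>24 * (real K * 2 ^ (d + 1 - k)) / eps\<rceil>)"
  have tb: "16 * 2 ^ k * L / eps \<le> real (t k)" "real (t k) \<le> 16 * 2 ^ k * L / eps + 1" for k
    unfolding t_def using L1 eps by (intro nat_ceiling_bounds; simp)+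
  have ub: "24 * (real K * 2 ^ (d + 1 - k)) / eps \<le> real (u k)"
    "real (u k) \<le> 24 * (real K * 2 ^ (d + 1 - k)) / eps + 1" for k
    unfolding u_def using eps by (intro nat_ceiling_bounds; simp)+
  have mono: "mono t" unfolding t_def
    using eps L1 by (intro monoI nat_mono ceiling_mono divide_right_mono mult_right_mono mult_left_mono power_increasing) auto
  have anti: "antimono u" unfolding u_def
    using eps by (intro antimonoI nat_mono ceiling_mono divide_right_mono mult_left_mono power_increasing) auto
  \<comment> \<open>Absorbs the 1 lost to a ceiling into the leading constant: 24 becomes 25 and 32
    becomes 33.\<close>
  have absorb: "x \<le> (c + 1) * v" if "x \<le> c * v + 1" "1 \<le> v" for x c v :: real
    using that by (simp add: algebra_simps)
  have ub': "real (u k) \<le> 25 * (real K * 2 ^ (d + 1 - k)) / eps" for k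
  proof -
    have "1 * 1 \<le> real K * 2 ^ (d + 1 - k)" using K by (intro mult_mono) auto
    then have "1 \<le> real K * 2 ^ (d + 1 - k) / eps" using eps by (simp add: field_simps)
    moreover have "real (u k) \<le> 24 * (real K * 2 ^ (d + 1 - k) / eps) + 1" using ub(2)[of k] by simp
    ultimately have "real (u k) \<le> (24 + 1) * (real K * 2 ^ (d + 1 - k) / eps)" by (rule absorb[rotated])
    then show ?thesis by simp
  qed
  have tb': "real (t (Suc k)) \<le> 33 * (2 ^ k * L) / eps" for k
  proof -
    have "1 * 1 \<le> 2 ^ k * L" using L1 by (intro mult_mono) auto
    then have "1 \<le> 2 ^ k * L / eps" using eps by (simp add: field_simps)
    moreover have "real (t (Suc k)) \<le> 32 * (2 ^ k * L / eps) + 1" using tb(2)[of "Suc k"] by simp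
    ultimately have "real (t (Suc k)) \<le> (32 + 1) * (2 ^ k * L / eps)" by (rule absorb[rotated])
    then show ?thesis by simp
  qed
  have R: "2 ^ 2 ^ k * (1 - eps / 4 / 2) ^ t k \<le> \<eta>" for k
  proof -
    have "2 ^ 2 ^ k * (1 - eps / 4 / 2) ^ t k \<le> exp (real (2 ^ k)) * exp (- (eps / 4 / 2) * real (t k))"
      using eps by (intro mult_mono two_power_le_exp one_minus_power_le_exp) auto
    also have "\<dots> = exp (2 ^ k - eps * real (t k) / 8)" by (simp flip: exp_add)
    also have "\<dots> \<le> exp (- L)"
    proof -
      have "1 * L \<le> 2 ^ k * L" "2 ^ k * 1 \<le> 2 ^ k * L" using L1 by (intro mult_mono; simp)+
      then have "2 ^ k + L \<le> 2 ^ k * L + 2 ^ k * L" unfolding mult_1 mult_1_right by (rule add_mono[rotated])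
      also have "\<dots> \<le> eps * real (t k) / 8" using tb(1)[of k] eps by (simp add: field_simps)
      finally have "2 ^ k + L \<le> eps * real (t k) / 8" .
      then show ?thesis by simp
    qed
    also have "\<dots> \<le> \<eta>" using expL T\<eta> by simp
    finally show ?thesis .
  qed
  have C: "2 ^ (choose_le d s * 2 ^ (d + 1 - k)) * (1 - eps / 4 / 2) ^ u k \<le> \<eta>" if k: "k \<le> d" for k
  proof -
    let ?l = "real K * 2 ^ (d + 1 - k)" and ?x = "real d + 1"
    have "(2::real) ^ 1 \<le> 2 ^ (d + 1 - k)" using k by (intro power_increasing) auto
    then have "?x * 2 \<le> ?l" using K by (intro mult_mono) auto
    then have l: "2 * ?x \<le> ?l" by (simp add: algebra_simps)
    have "2 ^ (choose_le d s * 2 ^ (d + 1 - k)) * (1 - eps / 4 / 2) ^ u k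
      \<le> exp (real (choose_le d s * 2 ^ (d + 1 - k))) * exp (- (eps / 4 / 2) * real (u k))"
      using eps by (intro mult_mono two_power_le_exp one_minus_power_le_exp) auto
    also have "\<dots> = exp (?l - eps * real (u k) / 8)" unfolding K_def by (simp flip: exp_add)
    also have "\<dots> \<le> exp (- (4 * ?x))"
    proof -
      have "24 * ?l \<le> eps * real (u k)" using ub(1)[of k] eps by (simp add: field_simps)
      then have "?l - eps * real (u k) / 8 \<le> - (4 * ?x)" using l by linarith
      then show ?thesis by simp
    qed
    also have "\<dots> \<le> \<eta>"
    proof -
      have "2 * ?x \<le> ?x * ?x" using d1 by (intro mult_right_mono) auto
      then have "9 * ?x \<le> 1 + 4 * ?x + (4 * ?x)\<^sup>2 / 2" using d1 by (simp add: power2_eq_square algebra_simps)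
      also have "\<dots> \<le> exp (4 * ?x)" by (rule exp_lower_Taylor_quadratic) simp
      finally have "9 * ?x \<le> exp (4 * ?x)" .
      then have "1 / exp (4 * ?x) \<le> 1 / (9 * ?x)" by (intro divide_left_mono) auto
      then show ?thesis unfolding \<eta>_def exp_minus inverse_eq_divide .
    qed
    finally show ?thesis .
  qed
  \<comment> \<open>The factor \<open>u k / (eps / 4)\<close> is at most \<open>T\<close> and the
    miss probability at most \<open>T\<close> to the power -2, so the product is at most
    \<open>1 / T\<close>.\<close>
  have G: "real (u k) * (1 - eps / 4) ^ t k / (eps / 4) \<le> \<eta>" for k
  proof -
    have "real (u k) \<le> 25 * (real K * 2 ^ (d + 1)) / eps"
      using eps by (intro order_trans[OF ub'[of k]]) (intro divide_right_mono mult_left_mono power_increasing; simp)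
    then have "real (u k) / (eps / 4) \<le> 25 * (real K * 2 ^ (d + 1)) / eps / (eps / 4)"
      using eps by (intro divide_right_mono) auto
    also have "\<dots> = 200 * (real K * 2 ^ d / eps ^ 2)" by (simp add: power2_eq_square field_simps)
    also have "\<dots> \<le> 324 * real d ^ 2 * (real K * 2 ^ d / eps ^ 2)"
    proof (rule mult_right_mono)
      have "1 \<le> real d ^ 2" using d1 by simp
      then show "200 \<le> 324 * real d ^ 2" by linarith
    qed simp
    also have "\<dots> = T" unfolding T_def K_def by simp
    finally have a: "real (u k) / (eps / 4) \<le> T" .
    have b: "(1 - eps / 4) ^ t k \<le> exp (- (2 * L))"
    proof -
      have "16 * L \<le> 16 * 2 ^ k * L" using L1 by simp
      also have "\<dots> \<le> eps * real (t k)" using tb(1)[of k] eps by (simp add: field_simps)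
      finally have "2 * L \<le> eps * real (t k) / 4" using L1 by linarith
      then have "- (eps / 4) * real (t k) \<le> - (2 * L)" by simp
      then have "exp (- (eps / 4) * real (t k)) \<le> exp (- (2 * L))" by simp
      moreover have "(1 - eps / 4) ^ t k \<le> exp (- (eps / 4) * real (t k))"
        by (rule one_minus_power_le_exp) (use eps in simp)
      ultimately show ?thesis by (rule order_trans[rotated])
    qed
    have "real (u k) * (1 - eps / 4) ^ t k / (eps / 4) = real (u k) / (eps / 4) * (1 - eps / 4) ^ t k" by simp
    also have "\<dots> \<le> T * exp (- (2 * L))" using a b T0 eps by (intro mult_mono) auto
    also have "\<dots> = T * (exp (- L) * exp (- L))" by (simp flip: exp_add)
    also have "\<dots> = 1 / T" unfolding expL using T0 by simp
    finally show ?thesis using T\<eta> by simp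
  qed
  have qb: "(\<Sum>k\<le>d. real (t (Suc k)) * real (u k)) \<le> 11 * T * ln T"
  proof -
    have "real (t (Suc k)) * real (u k) \<le> 1650 * (real K * 2 ^ d * L / eps ^ 2)" if k: "k \<le> d" for k
    proof -
      have "real (t (Suc k)) * real (u k) \<le> 33 * (2 ^ k * L) / eps * (25 * (real K * 2 ^ (d + 1 - k)) / eps)"
        using eps L1 by (intro mult_mono tb' ub') auto
      also have "\<dots> = 825 * (real K * (2 ^ k * 2 ^ (d + 1 - k)) * L / eps ^ 2)"
        by (simp add: power2_eq_square)
      also have "(2::real) ^ k * 2 ^ (d + 1 - k) = 2 * 2 ^ d" using k by (simp flip: power_add)
      finally show ?thesis by simp
    qed
    then have "(\<Sum>k\<le>d. real (t (Suc k)) * real (u k)) \<le> (\<Sum>k\<le>d. 1650 * (real K * 2 ^ d * L / eps ^ 2))"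
      by (intro sum_mono) simp
    also have "\<dots> = (real d + 1) * 1650 * (real K * 2 ^ d * L / eps ^ 2)" by simp
    \<comment> \<open>Here 1650 is \<open>2 * 33 * 25\<close>, and 3564 is \<open>11 * 324\<close>,
      chosen to expose \<open>T\<close>.\<close>
    also have "\<dots> \<le> (3564 * real d ^ 2) * (real K * 2 ^ d * L / eps ^ 2)"
    proof (rule mult_right_mono)
      have "real d * 1 \<le> real d * real d" using d1 by (intro mult_left_mono) auto
      then have "real d \<le> real d ^ 2" by (simp add: power2_eq_square)
      then have "3564 * real d \<le> 3564 * real d ^ 2" by simp
      moreover have "(real d + 1) * 1650 \<le> 3564 * real d" using d1 by (simp add: algebra_simps)
      ultimately show "(real d + 1) * 1650 \<le> 3564 * real d ^ 2" by (rule order_trans[rotated])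
    qed (use L1 in simp)
    also have "\<dots> = 11 * T * ln T" unfolding T_def K_def L_def by simp
    finally show ?thesis .
  qed
  show "\<exists>Tst. nonadaptive_one_sided_tester n m (\<lambda>M. s_binary_rank s n m M \<le> d) eps (11 * T * ln T) Tst"
  proof (cases "n > 0 \<and> m > 0")
    case True
    have "\<exists>Tst. nonadaptive_one_sided_tester n m (\<lambda>M. s_cover s n m M d) (4 * (eps / 4)) (11 * T * ln T) Tst"
      by (rule staircase_tester[of n m "eps / 4" t u d \<eta>])
         (use True eps mono anti R C G qb in \<open>auto simp: \<eta>_def\<close>)
    then show ?thesis unfolding s_binary_rank_le_iff[OF s] by simp
  next
    case False
    \<comment> \<open>Every matrix with no entries has rank 0, so none is far and a tester without
      queries suffices.\<close>
    have "mdist n m M M = 0" for M unfolding mdist_def by simp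
    moreover have "s_cover s n m M d" for M
      using False s_cover_mono[OF s_cover_rows[OF s, of n m M]] s_cover_mono[OF s_cover_cols[OF s, of n m M]] by fastforce
    moreover have "eps * real n * real m = 0" using False by auto
    ultimately have nf: "\<not> eps_far n m (\<lambda>M. s_binary_rank s n m M \<le> d) eps M" for M
      unfolding eps_far_def s_binary_rank_le_iff[OF s] by (intro notI) (drule spec[of _ M], auto)
    have "0 \<le> T * ln T" using T0 L1 unfolding L_def by (intro mult_nonneg_nonneg) linarith+
    then show ?thesis
      by (intro consistency_tester[of "return_pmf ()" "\<lambda>_. {}"]) (use nf in auto)
  qed
qed

section \<open>Rank exactly \<open>d\<close>\<close>

text \<open>Certain acceptance passes to a stronger property, and soundness to any smaller class of
  far matrices.\<close>

lemma tester_weaken: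
  assumes "nonadaptive_one_sided_tester n m P e q T" "\<And>M. P' M \<Longrightarrow> P M"
    and "\<And>M. eps_far n m P' e' M \<Longrightarrow> eps_far n m P e M" "q \<le> q'"
  shows "nonadaptive_one_sided_tester n m P' e' q' T"
proof -
  have "Q \<subseteq> {1..n} \<times> {1..m} \<and> real (card Q) \<le> q' \<and> (\<forall>f g. (\<forall>p\<in>Q. f p = g p) \<longrightarrow> D f = D g)"
    if "(Q, D) \<in> set_pmf T" for Q D
    using bspec[OF conjunct1[OF assms(1)[unfolded nonadaptive_one_sided_tester_def]] that] assms(4) by simp
  moreover have "accept_prob T M = 1" if "P' M" for M
    using assms(1) assms(2)[OF that] unfolding nonadaptive_one_sided_tester_def by blast
  moreover have "1 - accept_prob T M \<ge> 2/3" if "eps_far n m P' e' M" for M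
    using assms(1) assms(3)[OF that] unfolding nonadaptive_one_sided_tester_def by blast
  ultimately show ?thesis unfolding nonadaptive_one_sided_tester_def by blast
qed

lemma rank_exactly_tester:
  assumes s: "s \<ge> 1" and d: "d \<ge> 1" and eps: "0 < eps" "eps < 1"
    and T_def: "T = 324 * real d ^ 2 * real (choose_le d s) * 2 ^ d / eps ^ 2"
  shows "\<exists>Tst. nonadaptive_one_sided_tester n m (\<lambda>M. s_binary_rank s n m M = d) eps (88 * T * ln T) Tst"
proof -
  have Tge: "324 * real d ^ 2 / eps ^ 2 \<le> T" and "324 * real d \<le> T"
    using query_parameter_ge[OF s d eps] unfolding T_def .
  then have T: "324 \<le> T" using d by simp
  then have "exp 1 \<le> T" using exp_le by linarith
  then have L: "1 \<le> ln T" using T by (simp add: ln_ge_iff)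
  have TL: "T * 1 \<le> T * ln T" using T L by (intro mult_left_mono) auto
  have tri: "real (mdist n m M M') > eps / 2 * real n * real m"
    if far: "eps_far n m (\<lambda>M. s_binary_rank s n m M = d) eps M"
      and near: "s_binary_rank s n m M'' = d" "real (mdist n m M' M'') \<le> eps / 2 * real n * real m" for M M' M''
  proof -
    have "real (mdist n m M M'') > eps * real n * real m" using far near(1) unfolding eps_far_def by blast
    moreover have "real (mdist n m M M'') \<le> real (mdist n m M M') + real (mdist n m M' M'')"
      using mdist_triangle[of n m M M'' M'] by linarith
    ultimately show ?thesis using near(2) by (simp add: algebra_simps)
  qed
  consider (low) "n < d \<or> m < d" | (small) "real n < 2 * real d / eps" "real m < 2 * real d / eps"
    | (large) "d \<le> n" "d \<le> m" "2 * real d / eps \<le> real n \<or> 2 * real d / eps \<le> real m"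
    by linarith
  then show ?thesis
  proof cases
    case low
    have "s_binary_rank s n m M \<le> n" "s_binary_rank s n m M \<le> m" for M
      unfolding s_binary_rank_le_iff[OF s] by (rule s_cover_rows[OF s] s_cover_cols[OF s])+
    \<comment> \<open>The property is empty, so the consistency tester rejects always, without any
      query.\<close>
    then have "s_binary_rank s n m M \<noteq> d" for M using low by (metis leD)
    then show ?thesis
      by (intro consistency_tester[of "return_pmf ()" "\<lambda>_. {}"]) (use T L in auto)
  next
    case small
    have "real n * real m \<le> (2 * real d / eps) * (2 * real d / eps)" using small by (intro mult_mono) auto
    also have "\<dots> = 4 * (real d ^ 2 / eps ^ 2)" by (simp add: power2_eq_square)
    also have "\<dots> \<le> 324 * (real d ^ 2 / eps ^ 2)" by (intro mult_right_mono) auto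
    also have "\<dots> \<le> T" using Tge by simp
    also have "\<dots> \<le> 88 * T * ln T" using TL T by linarith
    finally have q: "real n * real m \<le> 88 * T * ln T" .
    have "\<not> (\<exists>N. s_binary_rank s n m N = d \<and> (\<forall>(i, j)\<in>{1..n} \<times> {1..m}. N i j = M i j))"
      if "eps_far n m (\<lambda>M. s_binary_rank s n m M = d) eps M" for M
    proof
      assume "\<exists>N. s_binary_rank s n m N = d \<and> (\<forall>(i, j)\<in>{1..n} \<times> {1..m}. N i j = M i j)"
      then obtain N where N: "s_binary_rank s n m N = d" "\<forall>(i, j)\<in>{1..n} \<times> {1..m}. N i j = M i j" by blast
      have "{(i, j). i \<in> {1..n} \<and> j \<in> {1..m} \<and> M i j \<noteq> N i j} = {}" using N(2) by auto
      then have "mdist n m M N = 0" unfolding mdist_def by (simp only: card.empty)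
      moreover have "real (mdist n m M N) > eps * real n * real m" using that N(1) unfolding eps_far_def by blast
      moreover have "0 \<le> eps * real n * real m" using eps by simp
      ultimately show False by simp
    qed
    then show ?thesis
      by (intro consistency_tester[of "return_pmf ()" "\<lambda>_. {1..n} \<times> {1..m}"]) (use q in auto)
  next
    case large
    \<comment> \<open>Replacing \<open>d\<close> rows costs at most \<open>d * m\<close>, which is
      within \<open>eps / 2 * n * m\<close> once \<open>n \<ge> 2 * d / eps\<close>; if
      \<open>m\<close> is the large side, the transpose is treated.\<close>
    have near: "\<exists>M''. s_binary_rank s n m M'' = d \<and> real (mdist n m M' M'') \<le> eps / 2 * real n * real m"
      if rk: "s_binary_rank s n m M' \<le> d" for M'
      using large(3)
    proof
      assume "2 * real d / eps \<le> real n"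
      then have "real d * real m \<le> eps / 2 * real n * real m" using eps by (intro mult_right_mono) (auto simp: field_simps)
      moreover obtain M'' where "s_binary_rank s n m M'' = d" "mdist n m M' M'' \<le> d * m"
        using exact_rank_nearby[OF s rk large(1,2)] by blast
      ultimately show ?thesis by (metis of_nat_le_iff of_nat_mult order_trans)
    next
      assume "2 * real d / eps \<le> real m"
      then have "real d * real n \<le> eps / 2 * real m * real n" using eps by (intro mult_right_mono) (auto simp: field_simps)
      then have le: "real d * real n \<le> eps / 2 * real n * real m" by (simp add: mult_ac)
      obtain N where N: "s_binary_rank s m n N = d" "mdist m n (mtransp M') N \<le> d * n"
        using exact_rank_nearby[OF s, of m n "mtransp M'" d] rk large(1,2) s_binary_rank_transpose[OF s, of m n M'] by auto
      have "s_binary_rank s n m (mtransp N) = d" using N(1) s_binary_rank_transpose[OF s, of n m N] by simp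
      moreover have "real (mdist n m M' (mtransp N)) \<le> eps / 2 * real n * real m"
      proof -
        have "mdist n m M' (mtransp N) = mdist m n (mtransp M') N" using mdist_transpose[of m n M' "mtransp N"] by simp
        then have "real (mdist n m M' (mtransp N)) \<le> real (d * n)" using N(2) by (simp only: of_nat_le_iff)
        then show ?thesis using le by simp
      qed
      ultimately show ?thesis by blast
    qed
    have "324 * real d ^ 2 * real (choose_le d s) * 2 ^ d / (eps / 2) ^ 2 = 4 * T"
      unfolding T_def by (simp add: power2_eq_square)
    then obtain Tst where Tst: "nonadaptive_one_sided_tester n m (\<lambda>M. s_binary_rank s n m M \<le> d) (eps / 2) (11 * (4 * T) * ln (4 * T)) Tst"
      using rank_at_most_tester[OF s d, of "eps / 2" "4 * T" n m] eps by auto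
    \<comment> \<open>Halving \<open>eps\<close> multiplies \<open>T\<close> by 4 and the logarithm
      by at most 2, whence the constant \<open>88 = 11 * 4 * 2\<close>.\<close>
    have "ln (4 * T) \<le> ln (T * T)" using T by (subst ln_le_cancel_iff) auto
    then have "ln (4 * T) \<le> 2 * ln T" using T by (simp add: ln_mult)
    then have "44 * T * ln (4 * T) \<le> 44 * T * (2 * ln T)" using T by (intro mult_left_mono) auto
    then have "11 * (4 * T) * ln (4 * T) \<le> 88 * T * ln T" by simp
    then have "nonadaptive_one_sided_tester n m (\<lambda>M. s_binary_rank s n m M = d) eps (88 * T * ln T) Tst"
    proof (rule tester_weaken[OF Tst, rotated 2])
      fix M assume far: "eps_far n m (\<lambda>M. s_binary_rank s n m M = d) eps M"
      show "eps_far n m (\<lambda>M. s_binary_rank s n m M \<le> d) (eps / 2) M"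
        unfolding eps_far_def using near tri[OF far] by blast
    qed auto
    then show ?thesis by blast
  qed
qed

theorem theorem2:
  shows "\<exists>C::real. C > 0 \<and>
    (\<forall>(s::nat) (d::nat) (eps::real) (n::nat) (m::nat).
       s \<ge> 1 \<longrightarrow> d \<ge> 1 \<longrightarrow> 0 < eps \<longrightarrow> eps < 1 \<longrightarrow>
       (let T = 324 * real d ^ 2 * real (choose_le d s) * 2 ^ d / eps ^ 2 in
         (\<exists>Tst. nonadaptive_one_sided_tester n m
                  (\<lambda>M. s_binary_rank s n m M \<le> d) eps (C * T * ln T) Tst) \<and>
         (\<exists>Tst. nonadaptive_one_sided_tester n m
                  (\<lambda>M. s_binary_rank s n m M = d) eps (C * T * ln T) Tst)))"
proof (intro exI[of _ 88] conjI allI impI)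
  show "0 < (88::real)" by simp
  fix s d :: nat and eps :: real and n m :: nat
  assume s: "s \<ge> 1" and d: "d \<ge> 1" and eps: "0 < eps" "eps < 1"
  define T where "T = 324 * real d ^ 2 * real (choose_le d s) * 2 ^ d / eps ^ 2"
  have "324 * real d \<le> T" using query_parameter_ge(2)[OF s d eps] unfolding T_def .
  then have "1 \<le> T" using d by simp
  then have "0 \<le> T * ln T" by simp
  then have le: "11 * T * ln T \<le> 88 * T * ln T" by linarith
  obtain Tst where "nonadaptive_one_sided_tester n m (\<lambda>M. s_binary_rank s n m M \<le> d) eps (11 * T * ln T) Tst"
    using rank_at_most_tester[OF s d eps T_def] by blast
  then have "nonadaptive_one_sided_tester n m (\<lambda>M. s_binary_rank s n m M \<le> d) eps (88 * T * ln T) Tst"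
    by (rule tester_weaken) (use le in auto)
  then show "let T = 324 * real d ^ 2 * real (choose_le d s) * 2 ^ d / eps ^ 2 in
         (\<exists>Tst. nonadaptive_one_sided_tester n m (\<lambda>M. s_binary_rank s n m M \<le> d) eps (88 * T * ln T) Tst) \<and>
         (\<exists>Tst. nonadaptive_one_sided_tester n m (\<lambda>M. s_binary_rank s n m M = d) eps (88 * T * ln T) Tst)"
    unfolding Let_def T_def[symmetric] using rank_exactly_tester[OF s d eps T_def] by blast
qed

end
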